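(* Let $P$ and $A$ be unital algebras over a field $k$ with $A$ finite-dimensional, and let $P$ be a left $A$-module under an action $\triangleright:A\otimes P\to P$. Let $$M=\{m\in P\mid a\triangleright(um)=(a\triangleright u)m\ \ \forall u\in P,\ a\in A\},$$ and let $\chi:A\otimes P\otimes_M P\to P$, $\chi(a\otimes u\otimes_M v)=(a\triangleright u)v$. Suppose the action is Galois, i.e. there is a linear map $\chi^\#:P\to P\otimes_M P\otimes A$ such that $$\mathrm{tr}_A(\chi^\#\circ\chi)=\mathrm{id}_{P\otimes_M P},\qquad (\chi\otimes \mathrm{id}_A)(\mathrm{id}_A\otimes\chi^\#)=\tau:A\otimes P\to P\otimes A .$$ Then there exists a unique algebra factorisation $X=P\underline{\otimes}_\Psi A$ (i.e. a unique factorisation map $\Psi:A\otimes P\to P\otimes A$) such that $P,A$ form an algebra bundle $P(M,A,\Psi,\tilde e)$ and $P$ is a $\Psi$-module via the product in $P$ and the action $\triangleright$. Explicitly, writing $\chi^\#(1)=\chi^{\#(1)}\otimes\chi^{\#(2)}$ with $\chi^{\#(1)}\in P\otimes_M P$ and $\chi^{\#(2)}\in A$ (summation understood), $$\Psi(a\otimes u)=\chi(a\otimes u\,\chi^{\#(1)})\otimes\chi^{\#(2)},\qquad \tilde e(a)=a\triangleright 1,\qquad\forall a\in A,\ u\in P.$$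
   Context: All algebras are unital over a field $k$; $\otimes=\otimes_k$; $\tau$ is the flip. For a basis $\{e_a\}$ of $A$ with dual basis $\{f^a\}$, $\mathrm{tr}_A(\chi^\#\circ\chi)$ is the map $x\mapsto\sum_a(\mathrm{id}\otimes f^a)\chi^\#(\chi(e_a\otimes x))$ on $P\otimes_MP$. In $u\chi^{\#(1)}$, $u$ multiplies the left factor of $P\otimes_M P$. A factorisation datum $(P,A,\Psi)$ consists of algebras $P,A$ and a linear map $\Psi:A\otimes P\to P\otimes A$ (components $\Psi(a\otimes u)^{(1)}\otimes\Psi(a\otimes u)^{(2)}$) with $\Psi\circ(\cdot_A\otimes\mathrm{id})=(\mathrm{id}\otimes\cdot_A)\circ(\Psi\otimes\mathrm{id})\circ(\mathrm{id}\otimes\Psi)$, $\Psi(1\otimes u)=u\otimes1$, $\Psi\circ(\mathrm{id}\otimes\cdot_P)=(\cdot_P\otimes\mathrm{id})\circ(\mathrm{id}\otimes\Psi)\circ(\Psi\otimes\mathrm{id})$, $\Psi(a\otimes1)=1\otimes a$ for all $u\in P$, $a\in A$. Equivalently, it is an algebra factorisation: $X=P\otimes A$ is an algebra with product $(u\otimes a)(v\otimes b)=u\Psi(a\otimes v)b$, having $P,A$ as subalgebras with $P\otimes A\to X$ (multiplication) a linear isomorphism. A $\Psi$-module is a left $P$-module and left $A$-module $V$ with $a\triangleright(u\triangleright v)=\Psi(a\otimes u)^{(1)}\triangleright(\Psi(a\otimes u)^{(2)}\triangleright v)$ for all $a\in A,u\in P,v\in V$. An algebra bundle $P(M,A,\Psi,\tilde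 e)$ is a factorisation datum $(P,A,\Psi)$ with a linear map $\tilde e:A\to P$ satisfying $\tilde e(ab)=\Psi(a\otimes\tilde e(b))^{(1)}\tilde e(\Psi(a\otimes\tilde e(b))^{(2)})$ and $\tilde e(1)=1$ such that, with the action $a\triangleright u=\Psi(a\otimes u)^{(1)}\tilde e(\Psi(a\otimes u)^{(2)})$ and the subalgebra $M=\{m\in P\mid a\triangleright m=\tilde e(a)m\ \forall a\in A\}$, the map $\chi(a\otimes u\otimes_Mv)=(a\triangleright u)v$ admits a map $\chi^\#$ satisfying the two displayed identities in the claim. *)

theory Defs
  imports "HOL-Algebra.Module" "HOL-Algebra.AbelCoset"
begin

section \<open>Algebras and linear maps\<close>

text \<open>
  The locale \<open>algebra\<close> of HOL-Algebra requires commutativity, so (noncommutative) unital algebras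
  are introduced here. The zero algebra is allowed.
\<close>

locale unital_algebra = module K P + ring P for K (structure) and P (structure) +
  assumes smult_mult_left:
      "\<lbrakk>c \<in> carrier K; x \<in> carrier P; y \<in> carrier P\<rbrakk> \<Longrightarrow>
        (c \<odot>\<^bsub>P\<^esub> x) \<otimes>\<^bsub>P\<^esub> y = c \<odot>\<^bsub>P\<^esub> (x \<otimes>\<^bsub>P\<^esub> y)"
    and smult_mult_right:
      "\<lbrakk>c \<in> carrier K; x \<in> carrier P; y \<in> carrier P\<rbrakk> \<Longrightarrow>
        x \<otimes>\<^bsub>P\<^esub> (c \<odot>\<^bsub>P\<^esub> y) = c \<odot>\<^bsub>P\<^esub> (x \<otimes>\<^bsub>P\<^esub> y)"

text \<open>Linear maps are extensional, so that equality of linear maps is equality on the carrier.\<close>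

definition linear_maps ::
    "('k, 'r) ring_scheme \<Rightarrow> ('k, 'v, 's) module_scheme \<Rightarrow> ('k, 'w, 't) module_scheme \<Rightarrow> ('v \<Rightarrow> 'w) set"
  where "linear_maps K V W =
    {f \<in> carrier V \<rightarrow>\<^sub>E carrier W.
      (\<forall>x\<in>carrier V. \<forall>y\<in>carrier V. f (x \<oplus>\<^bsub>V\<^esub> y) = f x \<oplus>\<^bsub>W\<^esub> f y) \<and>
      (\<forall>c\<in>carrier K. \<forall>x\<in>carrier V. f (c \<odot>\<^bsub>V\<^esub> x) = c \<odot>\<^bsub>W\<^esub> f x)}"

text \<open>A left module over the unital algebra \<open>A\<close> on the vector space \<open>V\<close>; the action is given as a
  bilinear map.\<close>

locale left_alg_module = A: unital_algebra K A + V: module K V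
  for K :: "('k, 'r) ring_scheme" (structure)
    and A :: "('k, 'a, 's) module_scheme" (structure)
    and V :: "('k, 'v, 't) module_scheme" (structure) +
  fixes act :: "'a \<Rightarrow> 'v \<Rightarrow> 'v"
  assumes act_closed: "\<lbrakk>a \<in> carrier A; v \<in> carrier V\<rbrakk> \<Longrightarrow> act a v \<in> carrier V"
    and act_add_left: "\<lbrakk>a \<in> carrier A; b \<in> carrier A; v \<in> carrier V\<rbrakk> \<Longrightarrow>
      act (a \<oplus>\<^bsub>A\<^esub> b) v = act a v \<oplus>\<^bsub>V\<^esub> act b v"
    and act_add_right: "\<lbrakk>a \<in> carrier A; v \<in> carrier V; w \<in> carrier V\<rbrakk> \<Longrightarrow>
      act a (v \<oplus>\<^bsub>V\<^esub> w) = act a v \<oplus>\<^bsub>V\<^esub> act a w"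
    and act_smult_left: "\<lbrakk>c \<in> carrier K; a \<in> carrier A; v \<in> carrier V\<rbrakk> \<Longrightarrow>
      act (c \<odot>\<^bsub>A\<^esub> a) v = c \<odot>\<^bsub>V\<^esub> act a v"
    and act_smult_right: "\<lbrakk>c \<in> carrier K; a \<in> carrier A; v \<in> carrier V\<rbrakk> \<Longrightarrow>
      act a (c \<odot>\<^bsub>V\<^esub> v) = c \<odot>\<^bsub>V\<^esub> act a v"
    and act_mult: "\<lbrakk>a \<in> carrier A; b \<in> carrier A; v \<in> carrier V\<rbrakk> \<Longrightarrow>
      act (a \<otimes>\<^bsub>A\<^esub> b) v = act a (act b v)"
    and act_one: "v \<in> carrier V \<Longrightarrow> act \<one>\<^bsub>A\<^esub> v = v"


section \<open>Finite bases and coordinates\<close>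

definition finite_basis ::
    "('k, 'r) ring_scheme \<Rightarrow> ('k, 'v, 's) module_scheme \<Rightarrow> 'v set \<Rightarrow> bool"
  where "finite_basis K V E \<longleftrightarrow> finite E \<and> E \<subseteq> carrier V \<and>
    (\<forall>x\<in>carrier V. \<exists>!c. c \<in> E \<rightarrow>\<^sub>E carrier K \<and> (\<Oplus>\<^bsub>V\<^esub>e\<in>E. c e \<odot>\<^bsub>V\<^esub> e) = x)"

definition finite_dim :: "('k, 'r) ring_scheme \<Rightarrow> ('k, 'v, 's) module_scheme \<Rightarrow> bool"
  where "finite_dim K V \<longleftrightarrow> (\<exists>E. finite_basis K V E)"

text \<open>For \<open>e \<in> E\<close>, the functional \<open>coord K V E e\<close> is the element of the basis dual to \<open>E\<close> that
  belongs to \<open>e\<close>.\<close>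

definition coord ::
    "('k, 'r) ring_scheme \<Rightarrow> ('k, 'v, 's) module_scheme \<Rightarrow> 'v set \<Rightarrow> 'v \<Rightarrow> 'v \<Rightarrow> 'k"
  where "coord K V E e x =
    (THE c. c \<in> E \<rightarrow>\<^sub>E carrier K \<and> (\<Oplus>\<^bsub>V\<^esub>b\<in>E. c b \<odot>\<^bsub>V\<^esub> b) = x) e"


section \<open>Quotients and free vector spaces\<close>

text \<open>The record type of modules extends that of rings; the fields \<open>mult\<close> and \<open>one\<close> are irrelevant
  for vector spaces and left unspecified below.\<close>

definition quotient_module ::
    "('k, 'v, 's) module_scheme \<Rightarrow> 'v set \<Rightarrow> ('k, 'v set) module"
  where "quotient_module V N =
    \<lparr>carrier = a_rcosets\<^bsub>V\<^esub> N, monoid.mult = undefined, one = undefined,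
     zero = N, add = set_add V, smult = (\<lambda>c X. \<Union>x\<in>X. N +>\<^bsub>V\<^esub> (c \<odot>\<^bsub>V\<^esub> x))\<rparr>"

definition module_span ::
    "('k, 'r) ring_scheme \<Rightarrow> ('k, 'v, 's) module_scheme \<Rightarrow> 'v set \<Rightarrow> 'v set"
  where "module_span K V S = \<Inter>{N. submodule N K V \<and> S \<subseteq> N}"

definition free_module :: "('k, 'r) ring_scheme \<Rightarrow> 'x set \<Rightarrow> ('k, 'x \<Rightarrow> 'k) module"
  where "free_module K X =
    \<lparr>carrier = {f. range f \<subseteq> carrier K \<and> finite {x. f x \<noteq> \<zero>\<^bsub>K\<^esub>} \<and> {x. f x \<noteq> \<zero>\<^bsub>K\<^esub>} \<subseteq> X},
     monoid.mult = undefined, one = undefined,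
     zero = (\<lambda>_. \<zero>\<^bsub>K\<^esub>), add = (\<lambda>f g x. f x \<oplus>\<^bsub>K\<^esub> g x), smult = (\<lambda>c f x. c \<otimes>\<^bsub>K\<^esub> f x)\<rparr>"

definition single :: "('k, 'r) ring_scheme \<Rightarrow> 'x \<Rightarrow> 'x \<Rightarrow> 'k"
  where "single K x = (\<lambda>y. if y = x then \<one>\<^bsub>K\<^esub> else \<zero>\<^bsub>K\<^esub>)"

definition linear_extension ::
    "('k, 'r) ring_scheme \<Rightarrow> ('k, 'z, 't) module_scheme \<Rightarrow> ('x \<Rightarrow> 'z) \<Rightarrow> ('x \<Rightarrow> 'k) \<Rightarrow> 'z"
  where "linear_extension K Z h f = (\<Oplus>\<^bsub>Z\<^esub>x\<in>{x. f x \<noteq> \<zero>\<^bsub>K\<^esub>}. f x \<odot>\<^bsub>Z\<^esub> h x)"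


section \<open>Tensor products\<close>

definition bilinear_relators ::
    "('k, 'r) ring_scheme \<Rightarrow> ('k, 'v, 's) module_scheme \<Rightarrow> ('k, 'w, 't) module_scheme \<Rightarrow>
      ('v \<times> 'w \<Rightarrow> 'k) set"
  where "bilinear_relators K V W = (let F = free_module K (carrier V \<times> carrier W) in
    {single K (v \<oplus>\<^bsub>V\<^esub> v', w) \<ominus>\<^bsub>F\<^esub> (single K (v, w) \<oplus>\<^bsub>F\<^esub> single K (v', w)) | v v' w.
        v \<in> carrier V \<and> v' \<in> carrier V \<and> w \<in> carrier W} \<union>
    {single K (v, w \<oplus>\<^bsub>W\<^esub> w') \<ominus>\<^bsub>F\<^esub> (single K (v, w) \<oplus>\<^bsub>F\<^esub> single K (v, w')) | v w w'.
        v \<in> carrier V \<and> w \<in> carrier W \<and> w' \<in> carrier W} \<union>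
    {single K (c \<odot>\<^bsub>V\<^esub> v, w) \<ominus>\<^bsub>F\<^esub> c \<odot>\<^bsub>F\<^esub> single K (v, w) | c v w.
        c \<in> carrier K \<and> v \<in> carrier V \<and> w \<in> carrier W} \<union>
    {single K (v, c \<odot>\<^bsub>W\<^esub> w) \<ominus>\<^bsub>F\<^esub> c \<odot>\<^bsub>F\<^esub> single K (v, w) | c v w.
        c \<in> carrier K \<and> v \<in> carrier V \<and> w \<in> carrier W})"

definition balanced_relators ::
    "('k, 'r) ring_scheme \<Rightarrow> ('k, 'p, 's) module_scheme \<Rightarrow> 'p set \<Rightarrow> ('p \<times> 'p \<Rightarrow> 'k) set"
  where "balanced_relators K P M = (let F = free_module K (carrier P \<times> carrier P) in
    {single K (u \<otimes>\<^bsub>P\<^esub> m, v) \<ominus>\<^bsub>F\<^esub> single K (u, m \<otimes>\<^bsub>P\<^esub> v) | u m v.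
        u \<in> carrier P \<and> m \<in> M \<and> v \<in> carrier P})"

definition tensor_kernel ::
    "('k, 'r) ring_scheme \<Rightarrow> ('k, 'v, 's) module_scheme \<Rightarrow> ('k, 'w, 't) module_scheme \<Rightarrow>
      ('v \<times> 'w \<Rightarrow> 'k) set \<Rightarrow> ('v \<times> 'w \<Rightarrow> 'k) set"
  where "tensor_kernel K V W R =
    module_span K (free_module K (carrier V \<times> carrier W)) (bilinear_relators K V W \<union> R)"

text \<open>\<open>V \<otimes>\<^sub>K W\<close>, and its pure tensors.\<close>

definition tensor ::
    "('k, 'r) ring_scheme \<Rightarrow> ('k, 'v, 's) module_scheme \<Rightarrow> ('k, 'w, 't) module_scheme \<Rightarrow>
      ('k, ('v \<times> 'w \<Rightarrow> 'k) set) module"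
  where "tensor K V W =
    quotient_module (free_module K (carrier V \<times> carrier W)) (tensor_kernel K V W {})"

definition tens ::
    "('k, 'r) ring_scheme \<Rightarrow> ('k, 'v, 's) module_scheme \<Rightarrow> ('k, 'w, 't) module_scheme \<Rightarrow>
      'v \<Rightarrow> 'w \<Rightarrow> ('v \<times> 'w \<Rightarrow> 'k) set"
  where "tens K V W v w =
    tensor_kernel K V W {} +>\<^bsub>free_module K (carrier V \<times> carrier W)\<^esub> single K (v, w)"

text \<open>\<open>P \<otimes>\<^sub>M P\<close> for a subalgebra \<open>M\<close> of \<open>P\<close>, and its pure tensors.\<close>

definition tensor_over ::
    "('k, 'r) ring_scheme \<Rightarrow> ('k, 'p, 's) module_scheme \<Rightarrow> 'p set \<Rightarrow> ('k, ('p \<times> 'p \<Rightarrow> 'k) set) module"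
  where "tensor_over K P M =
    quotient_module (free_module K (carrier P \<times> carrier P))
      (tensor_kernel K P P (balanced_relators K P M))"

definition tens_over ::
    "('k, 'r) ring_scheme \<Rightarrow> ('k, 'p, 's) module_scheme \<Rightarrow> 'p set \<Rightarrow> 'p \<Rightarrow> 'p \<Rightarrow> ('p \<times> 'p \<Rightarrow> 'k) set"
  where "tens_over K P M u v =
    tensor_kernel K P P (balanced_relators K P M)
      +>\<^bsub>free_module K (carrier P \<times> carrier P)\<^esub> single K (u, v)"

text \<open>
  The linear map on a tensor product (over \<open>K\<close> or over \<open>M\<close>) with values in \<open>Z\<close> that is induced by a
  bilinear (resp. bilinear and \<open>M\<close>-balanced) map \<open>\<beta>\<close>: on a coset \<open>T\<close> it is the common value of the
  linear extension of \<open>\<beta>\<close> at the elements of \<open>T\<close>. In Sweedler-type notation,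
  \<open>tensor_lift K Z \<beta> t\<close> is \<open>\<beta>(t\<^sup>(\<^sup>1\<^sup>), t\<^sup>(\<^sup>2\<^sup>))\<close> for \<open>t = t\<^sup>(\<^sup>1\<^sup>) \<otimes> t\<^sup>(\<^sup>2\<^sup>)\<close>, summation understood.
\<close>

definition tensor_lift ::
    "('k, 'r) ring_scheme \<Rightarrow> ('k, 'z, 't) module_scheme \<Rightarrow> ('v \<Rightarrow> 'w \<Rightarrow> 'z) \<Rightarrow> ('v \<times> 'w \<Rightarrow> 'k) set \<Rightarrow> 'z"
  where "tensor_lift K Z \<beta> T = the_elem (linear_extension K Z (\<lambda>(v, w). \<beta> v w) ` T)"

definition tensor_map ::
    "('k, 'r) ring_scheme \<Rightarrow> ('k, 'v, 's) module_scheme \<Rightarrow> ('k, 'w, 't) module_scheme \<Rightarrow>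
      ('x \<Rightarrow> 'v) \<Rightarrow> ('y \<Rightarrow> 'w) \<Rightarrow> ('x \<times> 'y \<Rightarrow> 'k) set \<Rightarrow> ('v \<times> 'w \<Rightarrow> 'k) set"
  \<comment> \<open>\<open>f \<otimes> g : X \<otimes> Y \<rightarrow> V \<otimes> W\<close>; the arguments \<open>V\<close> and \<open>W\<close> are the codomains\<close>
  where "tensor_map K V W f g = tensor_lift K (tensor K V W) (\<lambda>x y. tens K V W (f x) (g y))"

definition flip ::
    "('k, 'r) ring_scheme \<Rightarrow> ('k, 'v, 's) module_scheme \<Rightarrow> ('k, 'w, 't) module_scheme \<Rightarrow>
      ('v \<times> 'w \<Rightarrow> 'k) set \<Rightarrow> ('w \<times> 'v \<Rightarrow> 'k) set"
  where "flip K V W = tensor_lift K (tensor K W V) (\<lambda>v w. tens K W V w v)"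

definition assoc_right ::
    "('k, 'r) ring_scheme \<Rightarrow> ('k, 'u, 's) module_scheme \<Rightarrow> ('k, 'v, 't) module_scheme \<Rightarrow>
      ('k, 'w, 'q) module_scheme \<Rightarrow>
      (('u \<times> 'v \<Rightarrow> 'k) set \<times> 'w \<Rightarrow> 'k) set \<Rightarrow> ('u \<times> ('v \<times> 'w \<Rightarrow> 'k) set \<Rightarrow> 'k) set"
  \<comment> \<open>\<open>(U \<otimes> V) \<otimes> W \<rightarrow> U \<otimes> (V \<otimes> W)\<close>\<close>
  where "assoc_right K U V W =
    tensor_lift K (tensor K U (tensor K V W))
      (\<lambda>t w. tensor_lift K (tensor K U (tensor K V W))
        (\<lambda>u v. tens K U (tensor K V W) u (tens K V W v w)) t)"

definition assoc_left ::
    "('k, 'r) ring_scheme \<Rightarrow> ('k, 'u, 's) module_scheme \<Rightarrow> ('k, 'v, 't) module_scheme \<Rightarrow>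
      ('k, 'w, 'q) module_scheme \<Rightarrow>
      ('u \<times> ('v \<times> 'w \<Rightarrow> 'k) set \<Rightarrow> 'k) set \<Rightarrow> (('u \<times> 'v \<Rightarrow> 'k) set \<times> 'w \<Rightarrow> 'k) set"
  \<comment> \<open>\<open>U \<otimes> (V \<otimes> W) \<rightarrow> (U \<otimes> V) \<otimes> W\<close>\<close>
  where "assoc_left K U V W =
    tensor_lift K (tensor K (tensor K U V) W)
      (\<lambda>u t. tensor_lift K (tensor K (tensor K U V) W)
        (\<lambda>v w. tens K (tensor K U V) W (tens K U V u v) w) t)"

definition mult_map ::
    "('k, 'r) ring_scheme \<Rightarrow> ('k, 'a, 's) module_scheme \<Rightarrow> ('a \<times> 'a \<Rightarrow> 'k) set \<Rightarrow> 'a"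
  where "mult_map K A = tensor_lift K A (\<lambda>a b. a \<otimes>\<^bsub>A\<^esub> b)"

text \<open>
  The partial trace over the finite-dimensional space \<open>A\<close> of a linear map \<open>\<phi> : A \<otimes> W \<rightarrow> W \<otimes> A\<close>. It
  does not depend on the choice of the basis.
\<close>

definition partial_trace ::
    "('k, 'r) ring_scheme \<Rightarrow> ('k, 'a, 's) module_scheme \<Rightarrow> ('k, 'w, 't) module_scheme \<Rightarrow>
      (('a \<times> 'w \<Rightarrow> 'k) set \<Rightarrow> ('w \<times> 'a \<Rightarrow> 'k) set) \<Rightarrow> 'w \<Rightarrow> 'w"
  where "partial_trace K A W \<phi> x =
    (let E = (SOME E. finite_basis K A E) in
      \<Oplus>\<^bsub>W\<^esub>e\<in>E. tensor_lift K W (\<lambda>w a. coord K A E e a \<odot>\<^bsub>W\<^esub> w) (\<phi> (tens K A W e x)))"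


section \<open>Factorisations, modules over them, and algebra bundles\<close>

definition factorisation_datum ::
    "('k, 'r) ring_scheme \<Rightarrow> ('k, 'p, 's) module_scheme \<Rightarrow> ('k, 'a, 't) module_scheme \<Rightarrow>
      (('a \<times> 'p \<Rightarrow> 'k) set \<Rightarrow> ('p \<times> 'a \<Rightarrow> 'k) set) \<Rightarrow> bool"
  where "factorisation_datum K P A \<Psi> \<longleftrightarrow>
    unital_algebra K P \<and> unital_algebra K A \<and>
    \<Psi> \<in> linear_maps K (tensor K A P) (tensor K P A) \<and>
    (\<forall>x\<in>carrier (tensor K (tensor K A A) P).
      \<Psi> (tensor_map K A P (mult_map K A) id x) =
      tensor_map K P A id (mult_map K A)
        (assoc_right K P A A
          (tensor_map K (tensor K P A) A \<Psi> id
            (assoc_left K A P A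
              (tensor_map K A (tensor K P A) id \<Psi>
                (assoc_right K A A P x)))))) \<and>
    (\<forall>u\<in>carrier P. \<Psi> (tens K A P \<one>\<^bsub>A\<^esub> u) = tens K P A u \<one>\<^bsub>A\<^esub>) \<and>
    (\<forall>x\<in>carrier (tensor K A (tensor K P P)).
      \<Psi> (tensor_map K A P id (mult_map K P) x) =
      tensor_map K P A (mult_map K P) id
        (assoc_left K P P A
          (tensor_map K P (tensor K P A) id \<Psi>
            (assoc_right K P A P
              (tensor_map K (tensor K P A) P \<Psi> id
                (assoc_left K A P P x)))))) \<and>
    (\<forall>a\<in>carrier A. \<Psi> (tens K A P a \<one>\<^bsub>P\<^esub>) = tens K P A \<one>\<^bsub>P\<^esub> a)"

definition psi_module ::
    "('k, 'r) ring_scheme \<Rightarrow> ('k, 'p, 's) module_scheme \<Rightarrow> ('k, 'a, 't) module_scheme \<Rightarrow>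
      (('a \<times> 'p \<Rightarrow> 'k) set \<Rightarrow> ('p \<times> 'a \<Rightarrow> 'k) set) \<Rightarrow>
      ('k, 'v, 'q) module_scheme \<Rightarrow> ('p \<Rightarrow> 'v \<Rightarrow> 'v) \<Rightarrow> ('a \<Rightarrow> 'v \<Rightarrow> 'v) \<Rightarrow> bool"
  where "psi_module K P A \<Psi> V actP actA \<longleftrightarrow>
    left_alg_module K P V actP \<and> left_alg_module K A V actA \<and>
    (\<forall>a\<in>carrier A. \<forall>u\<in>carrier P. \<forall>v\<in>carrier V.
      actA a (actP u v) = tensor_lift K V (\<lambda>u' a'. actP u' (actA a' v)) (\<Psi> (tens K A P a u)))"

text \<open>\<open>\<chi> : A \<otimes> (P \<otimes>\<^sub>M P) \<rightarrow> P\<close>, \<open>a \<otimes> u \<otimes>\<^sub>M v \<mapsto> (a \<triangleright> u) v\<close>\<close>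

definition chi ::
    "('k, 'r) ring_scheme \<Rightarrow> ('k, 'p, 's) module_scheme \<Rightarrow> ('a \<Rightarrow> 'p \<Rightarrow> 'p) \<Rightarrow>
      ('a \<times> ('p \<times> 'p \<Rightarrow> 'k) set \<Rightarrow> 'k) set \<Rightarrow> 'p"
  where "chi K P act = tensor_lift K P (\<lambda>a. tensor_lift K P (\<lambda>u v. act a u \<otimes>\<^bsub>P\<^esub> v))"

text \<open>\<open>cs\<close> is a linear map \<open>\<chi>\<^sup># : P \<rightarrow> (P \<otimes>\<^sub>M P) \<otimes> A\<close> exhibiting the action as Galois.\<close>

definition galois_map ::
    "('k, 'r) ring_scheme \<Rightarrow> ('k, 'p, 's) module_scheme \<Rightarrow> ('k, 'a, 't) module_scheme \<Rightarrow> 'p set \<Rightarrow>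
      ('a \<Rightarrow> 'p \<Rightarrow> 'p) \<Rightarrow> ('p \<Rightarrow> (('p \<times> 'p \<Rightarrow> 'k) set \<times> 'a \<Rightarrow> 'k) set) \<Rightarrow> bool"
  where "galois_map K P A M act cs \<longleftrightarrow> (let W = tensor_over K P M in
    cs \<in> linear_maps K P (tensor K W A) \<and>
    (\<forall>x\<in>carrier W. partial_trace K A W (cs \<circ> chi K P act) x = x) \<and>
    (\<forall>y\<in>carrier (tensor K A P).
      tensor_map K P A (chi K P act) id
        (assoc_left K A W A (tensor_map K A (tensor K W A) id cs y)) = flip K A P y))"

definition bundle_action ::
    "('k, 'r) ring_scheme \<Rightarrow> ('k, 'p, 's) module_scheme \<Rightarrow> ('k, 'a, 't) module_scheme \<Rightarrow>
      (('a \<times> 'p \<Rightarrow> 'k) set \<Rightarrow> ('p \<times> 'a \<Rightarrow> 'k) set) \<Rightarrow> ('a \<Rightarrow> 'p) \<Rightarrow> 'a \<Rightarrow> 'p \<Rightarrow> 'p"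
  where "bundle_action K P A \<Psi> e a u =
    tensor_lift K P (\<lambda>u' a'. u' \<otimes>\<^bsub>P\<^esub> e a') (\<Psi> (tens K A P a u))"

definition algebra_bundle ::
    "('k, 'r) ring_scheme \<Rightarrow> ('k, 'p, 's) module_scheme \<Rightarrow> 'p set \<Rightarrow> ('k, 'a, 't) module_scheme \<Rightarrow>
      (('a \<times> 'p \<Rightarrow> 'k) set \<Rightarrow> ('p \<times> 'a \<Rightarrow> 'k) set) \<Rightarrow> ('a \<Rightarrow> 'p) \<Rightarrow> bool"
  where "algebra_bundle K P M A \<Psi> e \<longleftrightarrow>
    factorisation_datum K P A \<Psi> \<and> finite_dim K A \<and> e \<in> linear_maps K A P \<and>
    (\<forall>a\<in>carrier A. \<forall>b\<in>carrier A.
      e (a \<otimes>\<^bsub>A\<^esub> b) = tensor_lift K P (\<lambda>u' a'. u' \<otimes>\<^bsub>P\<^esub> e a') (\<Psi> (tens K A P a (e b)))) \<and>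
    e \<one>\<^bsub>A\<^esub> = \<one>\<^bsub>P\<^esub> \<and>
    M = {m \<in> carrier P. \<forall>a\<in>carrier A. bundle_action K P A \<Psi> e a m = e a \<otimes>\<^bsub>P\<^esub> m} \<and>
    (\<exists>cs. galois_map K P A M (bundle_action K P A \<Psi> e) cs)"

text \<open>Left multiplication by \<open>u\<close> on the left factor of \<open>P \<otimes>\<^sub>M P\<close>.\<close>

definition left_mult_over ::
    "('k, 'r) ring_scheme \<Rightarrow> ('k, 'p, 's) module_scheme \<Rightarrow> 'p set \<Rightarrow> 'p \<Rightarrow>
      ('p \<times> 'p \<Rightarrow> 'k) set \<Rightarrow> ('p \<times> 'p \<Rightarrow> 'k) set"
  where "left_mult_over K P M u =
    tensor_lift K (tensor_over K P M) (\<lambda>p q. tens_over K P M (u \<otimes>\<^bsub>P\<^esub> p) q)"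

end

theory Submission
  imports Defs
begin

text \<open>
  Every element of \<open>P \<otimes> A\<close> acts on \<open>P\<close> as a linear operator, with \<open>x \<otimes> a\<close> sending \<open>v\<close> to
  \<open>x (a \<triangleright> v)\<close>. The requirement that \<open>P\<close> is a \<open>\<Psi>\<close>-module says precisely that \<open>\<Psi> (a \<otimes> u)\<close> acts as the
  operator \<open>v \<mapsto> a \<triangleright> (u v)\<close>. Hence everything reduces to two questions: whether an element of \<open>P \<otimes> A\<close> is
  determined by its operator, and whether the operators \<open>v \<mapsto> a \<triangleright> (u v)\<close> come from \<open>P \<otimes> A\<close> at all. The
  second Galois identity settles the first question; the second question takes both identities.

  Write \<open>\<chi>\<^sup># 1 = w \<otimes> c\<close>, summation understood. The identity \<open>(\<chi> \<otimes> id)(id \<otimes> \<chi>\<^sup>#) = \<tau>\<close> at \<open>a \<otimes> 1\<close>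
  reads \<open>\<chi>(a \<otimes> w) \<otimes> c = 1 \<otimes> a\<close> (\<open>chi_cs_one\<close>). If \<open>t = x \<otimes> a\<close> acts as \<open>T\<close>, then \<open>x \<chi>(a \<otimes> p \<otimes> q) = T(p) q\<close>,
  so \<open>t = x \<chi>(a \<otimes> w) \<otimes> c\<close> is expressed through \<open>T\<close> alone; by linearity this formula holds for all
  \<open>t\<close> (\<open>recover_from_tensor_act\<close>) and the operator determines \<open>t\<close> (\<open>tensor_act_eqI\<close>). Applied to
  \<open>T(v) = a \<triangleright> (u v)\<close>, it gives \<open>\<chi>(a \<otimes> u w) \<otimes> c\<close>, the only possible value of \<open>\<Psi> (a \<otimes> u)\<close>.

  The trace identity shows that an element of \<open>P \<otimes>\<^sub>M P\<close> is determined by its images under all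
  \<open>\<chi>(a \<otimes> _)\<close> (\<open>chi_eqI\<close>). Comparing such images gives \<open>w (c \<triangleright> v) = v \<otimes>\<^sub>M 1\<close> (\<open>expand_in_cs_one\<close>), and
  multiplying by \<open>u\<close> on the left and applying \<open>\<chi>(a \<otimes> _)\<close> shows that the element above does act as
  \<open>v \<mapsto> a \<triangleright> (u v)\<close> (\<open>tensor_act_galois_psi\<close>).

  Since operators determine elements, each factorisation identity only has to be checked on
  operators, where it becomes an associativity law such as \<open>(a b) \<triangleright> (u v) = a \<triangleright> (b \<triangleright> (u v))\<close>. Evaluation
  of operators at \<open>1\<close> turns \<open>\<Psi>\<close> into the action and yields the bundle axioms for \<open>a \<mapsto> a \<triangleright> 1\<close>
  (\<open>algebra_bundle_act_on_one\<close>); conversely \<open>\<Psi> (a \<otimes> 1) = 1 \<otimes> a\<close> leaves no other map \<open>A \<rightarrow> P\<close>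
  whose bundle action is \<open>\<triangleright>\<close> (\<open>bundle_act_on_one_unique\<close>).

  The preliminary sections establish the universal property of the concrete coset construction of
  tensor products, for \<open>\<otimes>\<^sub>K\<close> and \<open>\<otimes>\<^sub>M\<close> at once.
\<close>

section \<open>Linear and bilinear maps\<close>

text \<open>
  Unlike \<open>linear_maps\<close>, this predicate ignores the values outside the carrier, so that it applies
  to \<open>\<lambda>\<close>-terms and is closed under composition of such terms.
\<close>

definition linear_on ::
    "('k, 'r) ring_scheme \<Rightarrow> ('k, 'v, 's) module_scheme \<Rightarrow> ('k, 'w, 't) module_scheme \<Rightarrow> ('v \<Rightarrow> 'w) \<Rightarrow> bool"
  where "linear_on K V W f \<longleftrightarrow>
    (\<forall>x\<in>carrier V. f x \<in> carrier W) \<and>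
    (\<forall>x\<in>carrier V. \<forall>y\<in>carrier V. f (x \<oplus>\<^bsub>V\<^esub> y) = f x \<oplus>\<^bsub>W\<^esub> f y) \<and>
    (\<forall>c\<in>carrier K. \<forall>x\<in>carrier V. f (c \<odot>\<^bsub>V\<^esub> x) = c \<odot>\<^bsub>W\<^esub> f x)"

definition bilinear_on ::
    "('k, 'r) ring_scheme \<Rightarrow> ('k, 'v, 's) module_scheme \<Rightarrow> ('k, 'w, 't) module_scheme \<Rightarrow>
      ('k, 'z, 'q) module_scheme \<Rightarrow> ('v \<Rightarrow> 'w \<Rightarrow> 'z) \<Rightarrow> bool"
  where "bilinear_on K V W Z \<beta> \<longleftrightarrow>
    (\<forall>v\<in>carrier V. linear_on K W Z (\<beta> v)) \<and> (\<forall>w\<in>carrier W. linear_on K V Z (\<lambda>v. \<beta> v w))"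

lemma linear_onI:
  assumes "\<And>x. x \<in> carrier V \<Longrightarrow> f x \<in> carrier W"
    and "\<And>x y. \<lbrakk>x \<in> carrier V; y \<in> carrier V\<rbrakk> \<Longrightarrow> f (x \<oplus>\<^bsub>V\<^esub> y) = f x \<oplus>\<^bsub>W\<^esub> f y"
    and "\<And>c x. \<lbrakk>c \<in> carrier K; x \<in> carrier V\<rbrakk> \<Longrightarrow> f (c \<odot>\<^bsub>V\<^esub> x) = c \<odot>\<^bsub>W\<^esub> f x"
  shows "linear_on K V W f"
  using assms unfolding linear_on_def by auto

lemma linear_onD:
  assumes "linear_on K V W f"
  shows linear_on_closed: "x \<in> carrier V \<Longrightarrow> f x \<in> carrier W"
    and linear_on_add: "\<lbrakk>x \<in> carrier V; y \<in> carrier V\<rbrakk> \<Longrightarrow> f (x \<oplus>\<^bsub>V\<^esub> y) = f x \<oplus>\<^bsub>W\<^esub> f y"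
    and linear_on_smult: "\<lbrakk>c \<in> carrier K; x \<in> carrier V\<rbrakk> \<Longrightarrow> f (c \<odot>\<^bsub>V\<^esub> x) = c \<odot>\<^bsub>W\<^esub> f x"
  using assms unfolding linear_on_def by auto

lemma bilinear_onI:
  assumes "\<And>v. v \<in> carrier V \<Longrightarrow> linear_on K W Z (\<beta> v)"
    and "\<And>w. w \<in> carrier W \<Longrightarrow> linear_on K V Z (\<lambda>v. \<beta> v w)"
  shows "bilinear_on K V W Z \<beta>"
  using assms unfolding bilinear_on_def by auto

lemma bilinear_onD:
  assumes "bilinear_on K V W Z \<beta>"
  shows bilinear_on_right: "v \<in> carrier V \<Longrightarrow> linear_on K W Z (\<beta> v)"
    and bilinear_on_left: "w \<in> carrier W \<Longrightarrow> linear_on K V Z (\<lambda>v. \<beta> v w)"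
  using assms unfolding bilinear_on_def by auto

lemma linear_on_compose:
  assumes "linear_on K U V f" "linear_on K V W g"
  shows "linear_on K U W (\<lambda>x. g (f x))"
  using assms unfolding linear_on_def by auto

lemma linear_on_cong:
  assumes "module K V" "\<And>x. x \<in> carrier V \<Longrightarrow> f x = g x"
  shows "linear_on K V W f \<longleftrightarrow> linear_on K V W g"
proof -
  interpret V: module K V by fact
  show ?thesis unfolding linear_on_def using assms(2) by simp
qed

lemma linear_on_id: "linear_on K V V (\<lambda>x. x)"
  unfolding linear_on_def by auto

lemma linear_on_zero:
  assumes "module K V" "module K W" "linear_on K V W f"
  shows "f \<zero>\<^bsub>V\<^esub> = \<zero>\<^bsub>W\<^esub>"
proof -
  interpret V: module K V by fact
  interpret W: module K W by fact
  have "f (\<zero>\<^bsub>K\<^esub> \<odot>\<^bsub>V\<^esub> \<zero>\<^bsub>V\<^esub>) = \<zero>\<^bsub>K\<^esub> \<odot>\<^bsub>W\<^esub> f \<zero>\<^bsub>V\<^esub>"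
    using assms(3) by (intro linear_on_smult) auto
  then show ?thesis using linear_on_closed[OF assms(3)] by simp
qed

lemma linear_on_minus:
  assumes "module K V" "module K W" "linear_on K V W f" "x \<in> carrier V"
  shows "f (\<ominus>\<^bsub>V\<^esub> x) = \<ominus>\<^bsub>W\<^esub> f x"
proof -
  interpret V: module K V by fact
  interpret W: module K W by fact
  have "f (\<ominus>\<^bsub>V\<^esub> x) \<oplus>\<^bsub>W\<^esub> f x = \<zero>\<^bsub>W\<^esub>"
    using assms linear_on_add[OF assms(3), of "\<ominus>\<^bsub>V\<^esub> x" x] linear_on_zero[OF assms(1-3)]
    by (simp add: V.l_neg)
  then show ?thesis
    using assms linear_on_closed[OF assms(3)] W.minus_equality by (metis V.a_inv_closed)
qed

lemma linear_on_diff: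
  assumes "module K V" "module K W" "linear_on K V W f" "x \<in> carrier V" "y \<in> carrier V"
  shows "f (x \<ominus>\<^bsub>V\<^esub> y) = f x \<ominus>\<^bsub>W\<^esub> f y"
proof -
  interpret V: module K V by fact
  show ?thesis
    using assms by (simp add: a_minus_def linear_on_add linear_on_minus)
qed

lemma linear_on_id_const: "linear_on K V V id"
  unfolding linear_on_def by simp

lemma bilinear_on_compose:
  assumes \<beta>: "bilinear_on K V W Z \<beta>" and f: "linear_on K V' V f" and g: "linear_on K W' W g"
  shows "bilinear_on K V' W' Z (\<lambda>x y. \<beta> (f x) (g y))"
proof (rule bilinear_onI)
  show "linear_on K W' Z (\<lambda>y. \<beta> (f x) (g y))" if "x \<in> carrier V'" for x
    by (rule linear_on_compose[OF g bilinear_on_right[OF \<beta> linear_on_closed[OF f that]]])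
  show "linear_on K V' Z (\<lambda>x. \<beta> (f x) (g y))" if "y \<in> carrier W'" for y
    by (rule linear_on_compose[OF f bilinear_on_left[OF \<beta> linear_on_closed[OF g that]]])
qed

lemma linear_on_bilinear:
  assumes "bilinear_on K V W Z \<beta>"
  shows linear_on_bilinear_left:
      "\<lbrakk>linear_on K X V f; w \<in> carrier W\<rbrakk> \<Longrightarrow> linear_on K X Z (\<lambda>x. \<beta> (f x) w)"
    and linear_on_bilinear_right:
      "\<lbrakk>linear_on K X W g; v \<in> carrier V\<rbrakk> \<Longrightarrow> linear_on K X Z (\<lambda>x. \<beta> v (g x))"
  by (rule linear_on_compose[OF _ bilinear_on_left[OF assms]], assumption+)
    (rule linear_on_compose[OF _ bilinear_on_right[OF assms]], assumption+)

lemma bilinear_compose_linear: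
  assumes \<beta>: "bilinear_on K V W Z \<beta>" and f: "linear_on K Z Z' f"
  shows "bilinear_on K V W Z' (\<lambda>x y. f (\<beta> x y))"
proof (rule bilinear_onI)
  show "linear_on K W Z' (\<lambda>y. f (\<beta> x y))" if "x \<in> carrier V" for x
    by (rule linear_on_compose[OF bilinear_on_right[OF \<beta> that] f])
  show "linear_on K V Z' (\<lambda>x. f (\<beta> x y))" if "y \<in> carrier W" for y
    by (rule linear_on_compose[OF bilinear_on_left[OF \<beta> that] f])
qed

lemma linear_on_linear_maps: "f \<in> linear_maps K V W \<Longrightarrow> linear_on K V W f"
  unfolding linear_maps_def linear_on_def by (auto dest: PiE_mem)

lemma restrict_linear_maps:
  assumes "module K V" "linear_on K V W f"
  shows "restrict f (carrier V) \<in> linear_maps K V W"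
proof -
  interpret module K V by fact
  show ?thesis using assms(2) unfolding linear_maps_def linear_on_def by auto
qed

section \<open>Quotients by submodules\<close>

context module
begin

lemma submodule_abelian_subgroup:
  assumes "submodule N R M"
  shows "abelian_subgroup N M"
  using assms submodule.axioms(1) M.abelian_group_axioms by (intro abelian_subgroupI3 additive_subgroup.intro) auto

lemma coset_eq_iff:
  assumes N: "submodule N R M" and "x \<in> carrier M" "y \<in> carrier M"
  shows "N +>\<^bsub>M\<^esub> x = N +>\<^bsub>M\<^esub> y \<longleftrightarrow> x \<oplus>\<^bsub>M\<^esub> \<ominus>\<^bsub>M\<^esub> y \<in> N"
proof -
  interpret N: abelian_subgroup N M by (rule submodule_abelian_subgroup[OF N])
  have "x \<in> N +>\<^bsub>M\<^esub> y \<longleftrightarrow> x \<oplus>\<^bsub>M\<^esub> \<ominus>\<^bsub>M\<^esub> y \<in> N"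
    by (rule N.a_rcos_module[OF assms(3,2)])
  moreover have "N +>\<^bsub>M\<^esub> x = N +>\<^bsub>M\<^esub> y \<longleftrightarrow> x \<in> N +>\<^bsub>M\<^esub> y"
  proof
    assume "N +>\<^bsub>M\<^esub> x = N +>\<^bsub>M\<^esub> y"
    then show "x \<in> N +>\<^bsub>M\<^esub> y" using N.a_rcos_self[OF assms(2)] by metis
  next
    assume "x \<in> N +>\<^bsub>M\<^esub> y"
    from N.a_repr_independence'[OF this assms(3)]
    show "N +>\<^bsub>M\<^esub> x = N +>\<^bsub>M\<^esub> y" by (rule sym)
  qed
  ultimately show ?thesis by (rule trans[rotated])
qed

lemma smult_coset:
  assumes N: "submodule N R M" and "c \<in> carrier R" "v \<in> carrier M"
  shows "c \<odot>\<^bsub>quotient_module M N\<^esub> (N +>\<^bsub>M\<^esub> v) = N +>\<^bsub>M\<^esub> (c \<odot>\<^bsub>M\<^esub> v)"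
proof -
  interpret N: abelian_subgroup N M by (rule submodule_abelian_subgroup[OF N])
  have "N +>\<^bsub>M\<^esub> (c \<odot>\<^bsub>M\<^esub> x) = N +>\<^bsub>M\<^esub> (c \<odot>\<^bsub>M\<^esub> v)" if x: "x \<in> N +>\<^bsub>M\<^esub> v" for x
  proof -
    have xM: "x \<in> carrier M" using x assms(3) N.a_elemrcos_carrier by blast
    have "x \<oplus>\<^bsub>M\<^esub> \<ominus>\<^bsub>M\<^esub> v \<in> N" using x xM assms(3) N.a_rcos_module by blast
    then have "c \<odot>\<^bsub>M\<^esub> (x \<oplus>\<^bsub>M\<^esub> \<ominus>\<^bsub>M\<^esub> v) \<in> N" using assms(2) submoduleE(4)[OF N] by blast
    then have "c \<odot>\<^bsub>M\<^esub> x \<oplus>\<^bsub>M\<^esub> \<ominus>\<^bsub>M\<^esub> (c \<odot>\<^bsub>M\<^esub> v) \<in> N"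
      using assms xM by (simp add: smult_r_distr smult_r_minus)
    then show ?thesis using coset_eq_iff[OF N] assms xM by blast
  qed
  then have "(\<Union>x\<in>N +>\<^bsub>M\<^esub> v. N +>\<^bsub>M\<^esub> (c \<odot>\<^bsub>M\<^esub> x)) = N +>\<^bsub>M\<^esub> (c \<odot>\<^bsub>M\<^esub> v)"
    by (intro UN_constant_eq[OF N.a_rcos_self[OF assms(3)]] ballI)
  then show ?thesis by (simp only: quotient_module_def module.simps)
qed

lemma add_coset:
  assumes N: "submodule N R M" and "v \<in> carrier M" "w \<in> carrier M"
  shows "(N +>\<^bsub>M\<^esub> v) \<oplus>\<^bsub>quotient_module M N\<^esub> (N +>\<^bsub>M\<^esub> w) = N +>\<^bsub>M\<^esub> (v \<oplus>\<^bsub>M\<^esub> w)"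
proof -
  interpret N: abelian_subgroup N M by (rule submodule_abelian_subgroup[OF N])
  show ?thesis using N.a_rcos_sum[OF assms(2,3)] by (simp only: quotient_module_def ring_record_simps)
qed

lemma carrier_quotient:
  "carrier (quotient_module M N) = (\<lambda>v. N +>\<^bsub>M\<^esub> v) ` carrier M"
  unfolding quotient_module_def A_RCOSETS_def RCOSETS_def a_r_coset_def r_coset_def by auto

lemma zero_coset:
  assumes N: "submodule N R M"
  shows "\<zero>\<^bsub>quotient_module M N\<^esub> = N +>\<^bsub>M\<^esub> \<zero>\<^bsub>M\<^esub>"
proof -
  interpret N: abelian_subgroup N M by (rule submodule_abelian_subgroup[OF N])
  show ?thesis using N.a_rcos_const[OF N.zero_closed] by (simp only: quotient_module_def ring_record_simps)
qed

lemma quotient_module_module: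
  assumes N: "submodule N R M"
  shows "module R (quotient_module M N)"
proof -
  note [simp] = add_coset[OF N] smult_coset[OF N] zero_coset[OF N] carrier_quotient
  show ?thesis
  proof (rule moduleI[OF R.is_cring])
    show "abelian_group (quotient_module M N)"
    proof (rule abelian_groupI)
      fix x assume "x \<in> carrier (quotient_module M N)"
      then obtain v where "v \<in> carrier M" "x = N +>\<^bsub>M\<^esub> v" by auto
      then show "\<exists>y\<in>carrier (quotient_module M N). y \<oplus>\<^bsub>quotient_module M N\<^esub> x = \<zero>\<^bsub>quotient_module M N\<^esub>"
        by (auto intro!: bexI[of _ "\<ominus>\<^bsub>M\<^esub> v"] simp: M.l_neg)
    qed (auto simp: M.a_ac)
  qed (auto simp: smult_l_distr smult_r_distr smult_assoc1)
qed

lemma module_span_submodule: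
  assumes "S \<subseteq> carrier M"
  shows "submodule (module_span R M S) R M"
    and "S \<subseteq> module_span R M S"
    and "\<And>N. \<lbrakk>submodule N R M; S \<subseteq> N\<rbrakk> \<Longrightarrow> module_span R M S \<subseteq> N"
proof -
  have 1: "module_span R M S \<subseteq> carrier M"
    unfolding module_span_def using assms carrier_is_submodule by blast
  have 2: "N \<noteq> {} \<Longrightarrow> submodule N R M \<Longrightarrow> \<zero>\<^bsub>M\<^esub> \<in> N" for N
    by (metis all_not_in_conv submoduleE(1) submoduleE(4) R.zero_closed smult_l_null subsetD)
  show "submodule (module_span R M S) R M"
    by (rule submoduleI[OF 1]) (auto simp: module_span_def intro: submoduleE(3,4,5) 2[OF submoduleE(2)])
qed (auto simp: module_span_def)

end

section \<open>Free modules\<close>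

lemma free_module_module:
  fixes K :: "('k, 'r) ring_scheme" and X :: "'x set"
  assumes "cring K"
  shows "module K (free_module K X)"
proof -
  interpret K: cring K by fact
  have fin: "finite {x. h x \<noteq> \<zero>\<^bsub>K\<^esub>} \<and> {x. h x \<noteq> \<zero>\<^bsub>K\<^esub>} \<subseteq> X"
    if "finite {x. f x \<noteq> \<zero>\<^bsub>K\<^esub>}" "finite {x. g x \<noteq> \<zero>\<^bsub>K\<^esub>}" "{x. f x \<noteq> \<zero>\<^bsub>K\<^esub>} \<subseteq> X" "{x. g x \<noteq> \<zero>\<^bsub>K\<^esub>} \<subseteq> X"
      "\<And>x. f x = \<zero>\<^bsub>K\<^esub> \<Longrightarrow> g x = \<zero>\<^bsub>K\<^esub> \<Longrightarrow> h x = \<zero>\<^bsub>K\<^esub>" for f g h :: "'x \<Rightarrow> 'k"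
  proof -
    have "{x. h x \<noteq> \<zero>\<^bsub>K\<^esub>} \<subseteq> {x. f x \<noteq> \<zero>\<^bsub>K\<^esub>} \<union> {x. g x \<noteq> \<zero>\<^bsub>K\<^esub>}" using that(5) by blast
    then show ?thesis using that(1-4) by (meson finite_UnI finite_subset le_sup_iff order_trans)
  qed
  have C: "carrier (free_module K X) = {f. (\<forall>x. f x \<in> carrier K) \<and> finite {x. f x \<noteq> \<zero>\<^bsub>K\<^esub>} \<and> {x. f x \<noteq> \<zero>\<^bsub>K\<^esub>} \<subseteq> X}"
    unfolding free_module_def by auto
  have sm: "(\<lambda>x. c \<otimes>\<^bsub>K\<^esub> f x) \<in> carrier (free_module K X)"
    if "c \<in> carrier K" "f \<in> carrier (free_module K X)" for c f
    using that fin[of f f "\<lambda>x. c \<otimes>\<^bsub>K\<^esub> f x"] unfolding C by auto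
  have ad: "(\<lambda>x. f x \<oplus>\<^bsub>K\<^esub> g x) \<in> carrier (free_module K X)"
    if "g \<in> carrier (free_module K X)" "f \<in> carrier (free_module K X)" for g f
    using that fin[of f g "\<lambda>x. f x \<oplus>\<^bsub>K\<^esub> g x"] unfolding C by auto
  have mi: "(\<lambda>x. \<ominus>\<^bsub>K\<^esub> f x) \<in> carrier (free_module K X)"
    if "f \<in> carrier (free_module K X)" for f
    using that fin[of f f "\<lambda>x. \<ominus>\<^bsub>K\<^esub> f x"] unfolding C by auto
  have ops: "add (free_module K X) = (\<lambda>f g x. f x \<oplus>\<^bsub>K\<^esub> g x)" "\<zero>\<^bsub>free_module K X\<^esub> = (\<lambda>_. \<zero>\<^bsub>K\<^esub>)"
    "smult (free_module K X) = (\<lambda>c f x. c \<otimes>\<^bsub>K\<^esub> f x)" unfolding free_module_def by auto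
  have pt: "f x \<in> carrier K" if "f \<in> carrier (free_module K X)" for f x
    using that unfolding C by auto
  show ?thesis
  proof (rule moduleI[OF assms])
    show "abelian_group (free_module K X)"
    proof (rule abelian_groupI)
      fix f assume "f \<in> carrier (free_module K X)"
      then show "\<exists>g\<in>carrier (free_module K X). g \<oplus>\<^bsub>free_module K X\<^esub> f = \<zero>\<^bsub>free_module K X\<^esub>"
        by (intro bexI[of _ "\<lambda>x. \<ominus>\<^bsub>K\<^esub> f x"] mi) (auto simp: ops K.l_neg pt)
    next
      show "\<zero>\<^bsub>free_module K X\<^esub> \<in> carrier (free_module K X)" unfolding ops C by simp
    qed (auto simp: ops pt K.a_ac ad)
  qed (auto simp: ops pt ad sm K.l_distr K.r_distr K.m_assoc)
qed

lemma single_carrier: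
  assumes "cring K" "x \<in> X"
  shows "single K x \<in> carrier (free_module K X)"
proof -
  interpret K: cring K by fact
  have "{y. single K x y \<noteq> \<zero>\<^bsub>K\<^esub>} \<subseteq> {x}" unfolding single_def by auto
  then show ?thesis
    using assms finite_subset unfolding free_module_def single_def by fastforce
qed

text \<open>
  Removing one point from the support at a time reduces a statement about all finitely supported
  functions to single generators; this is what makes pure tensors suffice later on.
\<close>

lemma free_module_induct [consumes 2, case_names zero step]:
  assumes "cring K" "f \<in> carrier (free_module K X)"
    and zero: "Q \<zero>\<^bsub>free_module K X\<^esub>"
    and step: "\<And>c x f. \<lbrakk>c \<in> carrier K; x \<in> X; f \<in> carrier (free_module K X); Q f\<rbrakk> \<Longrightarrow>
      Q (c \<odot>\<^bsub>free_module K X\<^esub> single K x \<oplus>\<^bsub>free_module K X\<^esub> f)"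
  shows "Q f"
proof -
  interpret K: cring K by fact
  have *: "finite S \<Longrightarrow> S = {x. f x \<noteq> \<zero>\<^bsub>K\<^esub>} \<Longrightarrow> f \<in> carrier (free_module K X) \<Longrightarrow> Q f" for S f
  proof (induction S arbitrary: f rule: finite_induct)
    case empty
    then have "f = \<zero>\<^bsub>free_module K X\<^esub>" unfolding free_module_def by auto
    then show ?case using zero by simp
  next
    case (insert a S)
    let ?g = "f(a := \<zero>\<^bsub>K\<^esub>)"
    have fK: "f x \<in> carrier K" for x using insert.prems(2) unfolding free_module_def by auto
    have aX: "a \<in> X" using insert.prems unfolding free_module_def by auto
    have S: "S = {x. ?g x \<noteq> \<zero>\<^bsub>K\<^esub>}" using insert.prems(1) insert.hyps(2) by auto
    have "S \<subseteq> X" using insert.prems unfolding free_module_def by auto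
    moreover have "range ?g \<subseteq> carrier K" using fK by auto
    ultimately have "range ?g \<subseteq> carrier K \<and> finite {x. ?g x \<noteq> \<zero>\<^bsub>K\<^esub>} \<and> {x. ?g x \<noteq> \<zero>\<^bsub>K\<^esub>} \<subseteq> X"
      using insert.hyps(1) by (simp only: S[symmetric])
    then have g: "?g \<in> carrier (free_module K X)"
      by (simp only: free_module_def partial_object.select_convs mem_Collect_eq)
    have "f = f a \<odot>\<^bsub>free_module K X\<^esub> single K a \<oplus>\<^bsub>free_module K X\<^esub> ?g"
      unfolding free_module_def single_def using fK by auto
    from this step[OF fK aX g insert.IH[OF S g]] show ?case by (rule ssubst[where P = Q])
  qed
  have "finite {x. f x \<noteq> \<zero>\<^bsub>K\<^esub>}" using assms(2) unfolding free_module_def by auto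
  then show ?thesis by (rule *[OF _ refl assms(2)])
qed

text \<open>
  The sum that defines the linear extension runs over the support of the function, which changes
  under addition; over a common larger finite set the sums can be added.
\<close>

lemma linear_extension_superset:
  assumes "module K Z" "finite S" "\<And>x. f x \<in> carrier K" "{x. f x \<noteq> \<zero>\<^bsub>K\<^esub>} \<subseteq> S" "h \<in> S \<rightarrow> carrier Z"
  shows "linear_extension K Z h f = (\<Oplus>\<^bsub>Z\<^esub>x\<in>S. f x \<odot>\<^bsub>Z\<^esub> h x)"
proof -
  interpret Z: module K Z by fact
  show ?thesis unfolding linear_extension_def
  proof (rule Z.add.finprod_mono_neutral_cong_left[OF assms(2,4)])
    show "\<And>i. i \<in> S - {x. f x \<noteq> \<zero>\<^bsub>K\<^esub>} \<Longrightarrow> f i \<odot>\<^bsub>Z\<^esub> h i = \<zero>\<^bsub>Z\<^esub>"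
      using funcset_mem[OF assms(5)] by auto
    show "(\<lambda>x. f x \<odot>\<^bsub>Z\<^esub> h x) \<in> S \<rightarrow> carrier Z" using assms(3,5) by auto
  qed auto
qed

lemma linear_extension_linear:
  assumes "module K Z" "h \<in> X \<rightarrow> carrier Z"
  shows "linear_on K (free_module K X) Z (linear_extension K Z h)"
    and "x \<in> X \<Longrightarrow> linear_extension K Z h (single K x) = h x"
proof -
  interpret Z: module K Z by fact
  have pt: "f x \<in> carrier K" "finite {x. f x \<noteq> \<zero>\<^bsub>K\<^esub>}" "{x. f x \<noteq> \<zero>\<^bsub>K\<^esub>} \<subseteq> X"
    if "f \<in> carrier (free_module K X)" for f x
    using that unfolding free_module_def by auto
  have ops: "add (free_module K X) = (\<lambda>f g x. f x \<oplus>\<^bsub>K\<^esub> g x)" "\<zero>\<^bsub>free_module K X\<^esub> = (\<lambda>_. \<zero>\<^bsub>K\<^esub>)"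
    "smult (free_module K X) = (\<lambda>c f x. c \<otimes>\<^bsub>K\<^esub> f x)" unfolding free_module_def by auto
  show "linear_on K (free_module K X) Z (linear_extension K Z h)"
  proof (rule linear_onI)
    fix f assume f: "f \<in> carrier (free_module K X)"
    have h: "h \<in> {x. f x \<noteq> \<zero>\<^bsub>K\<^esub>} \<rightarrow> carrier Z" using assms(2) pt(3)[OF f] by auto
    show "linear_extension K Z h f \<in> carrier Z" unfolding linear_extension_def
      using h pt(1)[OF f] by (intro Z.finsum_closed) auto
    { fix c assume c: "c \<in> carrier K"
      have "linear_extension K Z h (\<lambda>x. c \<otimes>\<^bsub>K\<^esub> f x) = (\<Oplus>\<^bsub>Z\<^esub>x\<in>{x. f x \<noteq> \<zero>\<^bsub>K\<^esub>}. (c \<otimes>\<^bsub>K\<^esub> f x) \<odot>\<^bsub>Z\<^esub> h x)"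
        using pt[OF f] h c by (intro linear_extension_superset assms) auto
      also have "\<dots> = (\<Oplus>\<^bsub>Z\<^esub>x\<in>{x. f x \<noteq> \<zero>\<^bsub>K\<^esub>}. c \<odot>\<^bsub>Z\<^esub> (f x \<odot>\<^bsub>Z\<^esub> h x))"
        using pt[OF f] h c by (intro Z.finsum_cong') (auto simp: Z.smult_assoc1 Pi_def)
      also have "\<dots> = c \<odot>\<^bsub>Z\<^esub> linear_extension K Z h f" unfolding linear_extension_def
        using pt[OF f] h c by (intro Z.finsum_smult_ldistr[symmetric]) auto
      finally show "linear_extension K Z h (c \<odot>\<^bsub>free_module K X\<^esub> f) = c \<odot>\<^bsub>Z\<^esub> linear_extension K Z h f"
        unfolding ops . }
    fix g assume g: "g \<in> carrier (free_module K X)"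
    let ?S = "{x. f x \<noteq> \<zero>\<^bsub>K\<^esub>} \<union> {x. g x \<noteq> \<zero>\<^bsub>K\<^esub>}"
    have hS: "h \<in> ?S \<rightarrow> carrier Z" using assms(2) pt(3)[OF f] pt(3)[OF g] by auto
    have fin: "finite ?S" using pt(2) f g by auto
    have "linear_extension K Z h (\<lambda>x. f x \<oplus>\<^bsub>K\<^esub> g x) = (\<Oplus>\<^bsub>Z\<^esub>x\<in>?S. (f x \<oplus>\<^bsub>K\<^esub> g x) \<odot>\<^bsub>Z\<^esub> h x)"
      using pt(1)[OF f] pt(1)[OF g] by (intro linear_extension_superset assms fin hS) auto
    also have "\<dots> = (\<Oplus>\<^bsub>Z\<^esub>x\<in>?S. f x \<odot>\<^bsub>Z\<^esub> h x \<oplus>\<^bsub>Z\<^esub> g x \<odot>\<^bsub>Z\<^esub> h x)"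
      using pt(1)[OF f] pt(1)[OF g] hS by (intro Z.finsum_cong') (auto simp: Z.smult_l_distr Pi_def)
    also have "\<dots> = (\<Oplus>\<^bsub>Z\<^esub>x\<in>?S. f x \<odot>\<^bsub>Z\<^esub> h x) \<oplus>\<^bsub>Z\<^esub> (\<Oplus>\<^bsub>Z\<^esub>x\<in>?S. g x \<odot>\<^bsub>Z\<^esub> h x)"
      using pt(1)[OF f] pt(1)[OF g] hS by (intro Z.finsum_addf) (auto simp: Pi_def)
    also have "\<dots> = linear_extension K Z h f \<oplus>\<^bsub>Z\<^esub> linear_extension K Z h g"
      using pt(1)[OF f] pt(1)[OF g]
      by (intro arg_cong2[of _ _ _ _ "add Z"] linear_extension_superset[symmetric] assms fin hS) auto
    finally show "linear_extension K Z h (f \<oplus>\<^bsub>free_module K X\<^esub> g) =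
        linear_extension K Z h f \<oplus>\<^bsub>Z\<^esub> linear_extension K Z h g" unfolding ops .
  qed
  show "linear_extension K Z h (single K x) = h x" if "x \<in> X"
  proof -
    have hx: "h x \<in> carrier Z" using that assms(2) by auto
    have "linear_extension K Z h (single K x) = (\<Oplus>\<^bsub>Z\<^esub>y\<in>{x}. single K x y \<odot>\<^bsub>Z\<^esub> h y)"
      using hx by (intro linear_extension_superset assms) (auto simp: single_def)
    also have "\<dots> = h x" using hx by (simp add: single_def)
    finally show ?thesis .
  qed
qed

section \<open>Tensor products and their universal property\<close>

text \<open>
  A common form of \<open>V \<otimes>\<^sub>K W\<close> and \<open>P \<otimes>\<^sub>M P\<close>: the tensor product over \<open>K\<close> with the additional relators
  \<open>R\<close> factored out. The choice \<open>R = {}\<close> gives the former, the balancing relators give the latter.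
\<close>

definition tensor_mod ::
    "('k, 'r) ring_scheme \<Rightarrow> ('k, 'v, 's) module_scheme \<Rightarrow> ('k, 'w, 't) module_scheme \<Rightarrow>
      ('v \<times> 'w \<Rightarrow> 'k) set \<Rightarrow> ('k, ('v \<times> 'w \<Rightarrow> 'k) set) module"
  where "tensor_mod K V W R =
    quotient_module (free_module K (carrier V \<times> carrier W)) (tensor_kernel K V W R)"

definition tensor_pure ::
    "('k, 'r) ring_scheme \<Rightarrow> ('k, 'v, 's) module_scheme \<Rightarrow> ('k, 'w, 't) module_scheme \<Rightarrow>
      ('v \<times> 'w \<Rightarrow> 'k) set \<Rightarrow> 'v \<Rightarrow> 'w \<Rightarrow> ('v \<times> 'w \<Rightarrow> 'k) set"
  where "tensor_pure K V W R v w =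
    tensor_kernel K V W R +>\<^bsub>free_module K (carrier V \<times> carrier W)\<^esub> single K (v, w)"

locale relative_tensor = V: module K V + W: module K W
  for K :: "('k, 'r) ring_scheme" (structure)
    and V :: "('k, 'v, 's) module_scheme" (structure)
    and W :: "('k, 'w, 't) module_scheme" (structure) +
  fixes R :: "('v \<times> 'w \<Rightarrow> 'k) set"
  assumes R_carrier: "R \<subseteq> carrier (free_module K (carrier V \<times> carrier W))"
begin

abbreviation "F \<equiv> free_module K (carrier V \<times> carrier W)"
abbreviation "N \<equiv> tensor_kernel K V W R"
abbreviation "T \<equiv> tensor_mod K V W R"

sublocale F: module K F
  by (rule free_module_module) (rule V.R.is_cring)

lemma single_F: "v \<in> carrier V \<Longrightarrow> w \<in> carrier W \<Longrightarrow> single K (v, w) \<in> carrier F"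
  by (rule single_carrier[OF V.R.is_cring]) simp

lemma relators_F: "bilinear_relators K V W \<subseteq> carrier F"
  unfolding bilinear_relators_def Let_def by (auto intro!: F.M.minus_closed single_F F.M.a_closed F.smult_closed)

lemma N_submodule: "submodule N K F" and relators_N: "bilinear_relators K V W \<union> R \<subseteq> N"
  and N_least: "submodule H K F \<Longrightarrow> bilinear_relators K V W \<union> R \<subseteq> H \<Longrightarrow> N \<subseteq> H"
proof -
  have "bilinear_relators K V W \<union> R \<subseteq> carrier F" using relators_F R_carrier by simp
  note span = F.module_span_submodule[OF this]
  show "submodule N K F" "bilinear_relators K V W \<union> R \<subseteq> N" unfolding tensor_kernel_def by (fact span)+
  show "submodule H K F \<Longrightarrow> bilinear_relators K V W \<union> R \<subseteq> H \<Longrightarrow> N \<subseteq> H"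
    unfolding tensor_kernel_def by (rule span(3))
qed

lemma T_module: "module K T"
  unfolding tensor_mod_def by (rule F.quotient_module_module[OF N_submodule])

lemma coset_eqI:
  assumes "x \<ominus>\<^bsub>F\<^esub> y \<in> N" "x \<in> carrier F" "y \<in> carrier F"
  shows "N +>\<^bsub>F\<^esub> x = N +>\<^bsub>F\<^esub> y"
  using assms F.coset_eq_iff[OF N_submodule] unfolding a_minus_def by simp

lemma pure_bilinear: "bilinear_on K V W T (tensor_pure K V W R)"
proof -
  let ?q = "\<lambda>v w. N +>\<^bsub>F\<^esub> single K (v, w)"
  have rel: "r \<in> N" if "r \<in> bilinear_relators K V W" for r using that relators_N by auto
  have closed: "?q v w \<in> carrier T" if "v \<in> carrier V" "w \<in> carrier W" for v w
    unfolding tensor_mod_def F.carrier_quotient using single_F that by blast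
  have sum: "?q v w \<oplus>\<^bsub>T\<^esub> ?q v' w' = N +>\<^bsub>F\<^esub> (single K (v, w) \<oplus>\<^bsub>F\<^esub> single K (v', w'))"
    if "v \<in> carrier V" "w \<in> carrier W" "v' \<in> carrier V" "w' \<in> carrier W" for v w v' w'
    unfolding tensor_mod_def using that by (intro F.add_coset N_submodule single_F)
  have mul: "c \<odot>\<^bsub>T\<^esub> ?q v w = N +>\<^bsub>F\<^esub> (c \<odot>\<^bsub>F\<^esub> single K (v, w))"
    if "c \<in> carrier K" "v \<in> carrier V" "w \<in> carrier W" for c v w
    unfolding tensor_mod_def using that by (intro F.smult_coset N_submodule single_F)
  have "?q v (w \<oplus>\<^bsub>W\<^esub> w') = ?q v w \<oplus>\<^bsub>T\<^esub> ?q v w'"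
    if "v \<in> carrier V" "w \<in> carrier W" "w' \<in> carrier W" for v w w'
    unfolding sum[OF that(1,2,1,3)]
  proof (rule coset_eqI[OF rel])
    show "single K (v, w \<oplus>\<^bsub>W\<^esub> w') \<ominus>\<^bsub>F\<^esub> (single K (v, w) \<oplus>\<^bsub>F\<^esub> single K (v, w')) \<in> bilinear_relators K V W"
      unfolding bilinear_relators_def Let_def using that by blast
  qed (simp_all add: that single_F)
  moreover have "?q (v \<oplus>\<^bsub>V\<^esub> v') w = ?q v w \<oplus>\<^bsub>T\<^esub> ?q v' w"
    if "v \<in> carrier V" "v' \<in> carrier V" "w \<in> carrier W" for v v' w
    unfolding sum[OF that(1,3,2,3)]
  proof (rule coset_eqI[OF rel])
    show "single K (v \<oplus>\<^bsub>V\<^esub> v', w) \<ominus>\<^bsub>F\<^esub> (single K (v, w) \<oplus>\<^bsub>F\<^esub> single K (v', w)) \<in> bilinear_relators K V W"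
      unfolding bilinear_relators_def Let_def using that by blast
  qed (simp_all add: that single_F)
  moreover have "?q (c \<odot>\<^bsub>V\<^esub> v) w = c \<odot>\<^bsub>T\<^esub> ?q v w"
    if "c \<in> carrier K" "v \<in> carrier V" "w \<in> carrier W" for c v w
    unfolding mul[OF that]
  proof (rule coset_eqI[OF rel])
    show "single K (c \<odot>\<^bsub>V\<^esub> v, w) \<ominus>\<^bsub>F\<^esub> c \<odot>\<^bsub>F\<^esub> single K (v, w) \<in> bilinear_relators K V W"
      unfolding bilinear_relators_def Let_def using that by blast
  qed (simp_all add: that single_F)
  moreover have "?q v (c \<odot>\<^bsub>W\<^esub> w) = c \<odot>\<^bsub>T\<^esub> ?q v w"
    if "c \<in> carrier K" "v \<in> carrier V" "w \<in> carrier W" for c v w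
    unfolding mul[OF that]
  proof (rule coset_eqI[OF rel])
    show "single K (v, c \<odot>\<^bsub>W\<^esub> w) \<ominus>\<^bsub>F\<^esub> c \<odot>\<^bsub>F\<^esub> single K (v, w) \<in> bilinear_relators K V W"
      unfolding bilinear_relators_def Let_def using that by blast
  qed (simp_all add: that single_F)
  ultimately show ?thesis
    unfolding tensor_pure_def by (intro bilinear_onI linear_onI closed)
qed

lemmas pure_linear_left = bilinear_on_left[OF pure_bilinear]
  and pure_linear_right = bilinear_on_right[OF pure_bilinear]

lemma pure_closed: "v \<in> carrier V \<Longrightarrow> w \<in> carrier W \<Longrightarrow> tensor_pure K V W R v w \<in> carrier T"
  using linear_on_closed[OF pure_linear_right] by blast

lemma pure_relator:
  assumes "single K (v, w) \<ominus>\<^bsub>F\<^esub> single K (v', w') \<in> R" 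
    "v \<in> carrier V" "w \<in> carrier W" "v' \<in> carrier V" "w' \<in> carrier W"
  shows "tensor_pure K V W R v w = tensor_pure K V W R v' w'"
  unfolding tensor_pure_def using assms relators_N by (intro coset_eqI single_F) auto

text \<open>
  Closure under addition is enough: \<open>c (v \<otimes> w) = (c v) \<otimes> w\<close> is again pure, and so is \<open>0 = 0 \<otimes> 0\<close>.
\<close>

lemma tensor_induct [consumes 1, case_names pure add]:
  assumes "t \<in> carrier T"
    and pure: "\<And>v w. \<lbrakk>v \<in> carrier V; w \<in> carrier W\<rbrakk> \<Longrightarrow> Q (tensor_pure K V W R v w)"
    and add: "\<And>s t. \<lbrakk>s \<in> carrier T; t \<in> carrier T; Q s; Q t\<rbrakk> \<Longrightarrow> Q (s \<oplus>\<^bsub>T\<^esub> t)"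
  shows "Q t"
proof -
  interpret T: module K T by (rule T_module)
  have smult: "c \<odot>\<^bsub>T\<^esub> tensor_pure K V W R v w = tensor_pure K V W R (c \<odot>\<^bsub>V\<^esub> v) w"
    if "c \<in> carrier K" "v \<in> carrier V" "w \<in> carrier W" for c v w
    using linear_on_smult[OF pure_linear_left] that by metis
  obtain f where f: "f \<in> carrier F" "t = N +>\<^bsub>F\<^esub> f"
    using assms(1) unfolding tensor_mod_def F.carrier_quotient by auto
  have "Q (N +>\<^bsub>F\<^esub> f)"
    using V.R.is_cring f(1)
  proof (induction rule: free_module_induct)
    case zero
    have "N +>\<^bsub>F\<^esub> \<zero>\<^bsub>F\<^esub> = \<zero>\<^bsub>T\<^esub>" unfolding tensor_mod_def F.zero_coset[OF N_submodule] ..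
    also have "\<dots> = tensor_pure K V W R \<zero>\<^bsub>V\<^esub> \<zero>\<^bsub>W\<^esub>"
      using linear_on_zero[OF W.module_axioms T_module pure_linear_right] by simp
    finally show ?case using pure by simp
  next
    case (step c x f)
    obtain v w where x: "x = (v, w)" "v \<in> carrier V" "w \<in> carrier W" using step by auto
    have "N +>\<^bsub>F\<^esub> (c \<odot>\<^bsub>F\<^esub> single K x \<oplus>\<^bsub>F\<^esub> f) = (c \<odot>\<^bsub>T\<^esub> tensor_pure K V W R v w) \<oplus>\<^bsub>T\<^esub> (N +>\<^bsub>F\<^esub> f)"
      unfolding tensor_mod_def tensor_pure_def
      using x step by (simp add: F.add_coset[OF N_submodule] F.smult_coset[OF N_submodule] single_F)
    also have "\<dots> = tensor_pure K V W R (c \<odot>\<^bsub>V\<^esub> v) w \<oplus>\<^bsub>T\<^esub> (N +>\<^bsub>F\<^esub> f)"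
      using x step smult by simp
    finally show ?case
      using add[of "tensor_pure K V W R (c \<odot>\<^bsub>V\<^esub> v) w" "N +>\<^bsub>F\<^esub> f"] pure x step
      by (simp add: pure_closed) (simp add: tensor_mod_def F.carrier_quotient)
  qed
  then show ?thesis using f by simp
qed

lemma linear_on_T_eqI:
  assumes "t \<in> carrier T" "linear_on K T Z f" "linear_on K T Z g"
    and "\<And>v w. \<lbrakk>v \<in> carrier V; w \<in> carrier W\<rbrakk> \<Longrightarrow> f (tensor_pure K V W R v w) = g (tensor_pure K V W R v w)"
  shows "f t = g t"
  using assms(1) by (induction rule: tensor_induct) (simp_all add: assms linear_on_add[OF assms(2)] linear_on_add[OF assms(3)])

text \<open>
  The bilinear maps that factor through the quotient by the relators \<open>R\<close>.
\<close>

definition compatible :: "('k, 'z, 'q) module_scheme \<Rightarrow> ('v \<Rightarrow> 'w \<Rightarrow> 'z) \<Rightarrow> bool"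
  where "compatible Z \<beta> \<longleftrightarrow> bilinear_on K V W Z \<beta> \<and>
    (\<forall>r\<in>R. linear_extension K Z (\<lambda>(v, w). \<beta> v w) r = \<zero>\<^bsub>Z\<^esub>)"

text \<open>
  The linear extension of \<open>\<beta>\<close> vanishes on all relators, hence on the submodule that they span,
  and is therefore constant on cosets. The set image in the definition of \<open>tensor_lift\<close> is thus a
  singleton.
\<close>

lemma compatible_lift:
  assumes Z: "module K Z" and comp: "compatible Z \<beta>"
  shows compatible_lift_linear: "linear_on K T Z (tensor_lift K Z \<beta>)"
    and compatible_lift_pure:
      "\<lbrakk>v \<in> carrier V; w \<in> carrier W\<rbrakk> \<Longrightarrow> tensor_lift K Z \<beta> (tensor_pure K V W R v w) = \<beta> v w"
proof -
  interpret Z: module K Z by fact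
  have \<beta>: "bilinear_on K V W Z \<beta>"
    and kill: "\<And>r. r \<in> R \<Longrightarrow> linear_extension K Z (\<lambda>(v, w). \<beta> v w) r = \<zero>\<^bsub>Z\<^esub>"
    using comp unfolding compatible_def by auto
  let ?L = "linear_extension K Z (\<lambda>(v, w). \<beta> v w)"
  note bil = bilinear_on_left[OF \<beta>] bilinear_on_right[OF \<beta>]
  have cl: "\<beta> v w \<in> carrier Z" if "v \<in> carrier V" "w \<in> carrier W" for v w
    using linear_on_closed[OF bil(2)] that by blast
  have "(\<lambda>(v, w). \<beta> v w) \<in> carrier V \<times> carrier W \<rightarrow> carrier Z" using cl by auto
  note L = linear_extension_linear[OF Z this]
  have LF: "linear_on K F Z ?L" by (rule L(1))
  have L1: "?L (single K (v, w)) = \<beta> v w" if "v \<in> carrier V" "w \<in> carrier W" for v w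
    using L(2)[of "(v, w)"] that by simp
  note Lsimps = linear_on_add[OF LF] linear_on_smult[OF LF] linear_on_diff[OF F.module_axioms Z LF]
    linear_on_minus[OF F.module_axioms Z LF] linear_on_zero[OF F.module_axioms Z LF] linear_on_closed[OF LF]
  have sub: "submodule {f \<in> carrier F. ?L f = \<zero>\<^bsub>Z\<^esub>} K F"
    by (rule F.submoduleI) (auto simp: Lsimps)
  have "?L r = \<zero>\<^bsub>Z\<^esub>" if "r \<in> bilinear_relators K V W" for r
    using that unfolding bilinear_relators_def Let_def
    by (auto simp: Lsimps L1 single_F cl linear_on_add[OF bil(1)] linear_on_add[OF bil(2)]
      linear_on_smult[OF bil(1)] linear_on_smult[OF bil(2)] Z.r_neg a_minus_def)
  then have N0: "N \<subseteq> {f \<in> carrier F. ?L f = \<zero>\<^bsub>Z\<^esub>}"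
    using kill relators_F R_carrier by (intro N_least[OF sub]) auto
  interpret N: abelian_subgroup N F by (rule F.submodule_abelian_subgroup[OF N_submodule])
  have val: "tensor_lift K Z \<beta> (N +>\<^bsub>F\<^esub> f) = ?L f" if f: "f \<in> carrier F" for f
  proof -
    have "?L g = ?L f" if g: "g \<in> N +>\<^bsub>F\<^esub> f" for g
    proof -
      have gF: "g \<in> carrier F" using g f N.a_elemrcos_carrier by blast
      then have "g \<oplus>\<^bsub>F\<^esub> \<ominus>\<^bsub>F\<^esub> f \<in> N" using g f N.a_rcos_module by blast
      then have "?L g \<oplus>\<^bsub>Z\<^esub> \<ominus>\<^bsub>Z\<^esub> ?L f = \<zero>\<^bsub>Z\<^esub>" using N0 gF f by (auto simp: Lsimps)
      then show ?thesis
        using Z.minus_equality[of "?L g" "\<ominus>\<^bsub>Z\<^esub> ?L f"] gF f by (simp add: Lsimps)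
    qed
    then have "?L ` (N +>\<^bsub>F\<^esub> f) = {?L f}" using N.a_rcos_self[OF f] by blast
    then show ?thesis unfolding tensor_lift_def by simp
  qed
  show "linear_on K T Z (tensor_lift K Z \<beta>)"
    unfolding tensor_mod_def
    by (rule linear_onI) (auto simp: F.carrier_quotient F.add_coset[OF N_submodule] F.smult_coset[OF N_submodule] val Lsimps)
  show "tensor_lift K Z \<beta> (tensor_pure K V W R v w) = \<beta> v w" if "v \<in> carrier V" "w \<in> carrier W"
    unfolding tensor_pure_def using that val L1 single_F by simp
qed

lemma lift_unique:
  assumes "module K Z" "compatible Z \<beta>" "t \<in> carrier T" "linear_on K T Z g"
    and "\<And>v w. \<lbrakk>v \<in> carrier V; w \<in> carrier W\<rbrakk> \<Longrightarrow> \<beta> v w = g (tensor_pure K V W R v w)"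
  shows "tensor_lift K Z \<beta> t = g t"
  by (rule linear_on_T_eqI[OF assms(3) compatible_lift_linear[OF assms(1,2)] assms(4)])
    (simp add: compatible_lift_pure[OF assms(1,2)] assms(5))

lemma lift_cong:
  assumes "module K Z" "compatible Z \<beta>" "compatible Z \<gamma>" "t \<in> carrier T"
    and "\<And>v w. \<lbrakk>v \<in> carrier V; w \<in> carrier W\<rbrakk> \<Longrightarrow> \<beta> v w = \<gamma> v w"
  shows "tensor_lift K Z \<beta> t = tensor_lift K Z \<gamma> t"
  by (rule lift_unique[OF assms(1,2,4) compatible_lift_linear[OF assms(1,3)]])
    (simp add: compatible_lift_pure[OF assms(1,3)] assms(5))

text \<open>
  Used whenever a lift depends on a further argument, as in \<open>a \<mapsto> \<chi>(a \<otimes> w)\<close> for a fixed tensor \<open>w\<close>.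
\<close>

lemma lift_parameter_linear:
  assumes X: "module K X" and Z: "module K Z" and t: "t \<in> carrier T"
    and \<beta>: "\<And>x. x \<in> carrier X \<Longrightarrow> compatible Z (\<beta> x)"
    and lin: "\<And>v w. \<lbrakk>v \<in> carrier V; w \<in> carrier W\<rbrakk> \<Longrightarrow> linear_on K X Z (\<lambda>x. \<beta> x v w)"
  shows "linear_on K X Z (\<lambda>x. tensor_lift K Z (\<beta> x) t)"
  using t
proof (induction rule: tensor_induct)
  case (pure v w)
  then show ?case
    by (subst linear_on_cong[OF X compatible_lift_pure[OF Z \<beta>]]) (simp_all add: lin)
next
  case (add s t)
  interpret X: module K X by fact
  interpret Z: module K Z by fact
  note sum = linear_on_add[OF compatible_lift_linear[OF Z \<beta>] add.hyps]
  note cl = linear_on_closed[OF add.IH(1)] linear_on_closed[OF add.IH(2)]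
  show ?case
    by (subst linear_on_cong[OF X sum], assumption, rule linear_onI)
      (simp_all add: cl linear_on_add[OF add.IH(1)] linear_on_add[OF add.IH(2)]
        linear_on_smult[OF add.IH(1)] linear_on_smult[OF add.IH(2)] Z.smult_r_distr Z.a_ac)
qed

end

section \<open>Tensor products over the ground ring\<close>

lemma tensor_eq_tensor_mod:
  "tensor K V W = tensor_mod K V W {}" "tens K V W = tensor_pure K V W {}"
  by (simp_all add: fun_eq_iff tensor_def tensor_mod_def tens_def tensor_pure_def)

context
  fixes K :: "('k, 'r) ring_scheme"
    and V :: "('k, 'v, 's) module_scheme" and W :: "('k, 'w, 't) module_scheme"
  assumes V: "module K V" and W: "module K W"
begin

interpretation T: relative_tensor K V W "{}"
  by (simp add: relative_tensor_def relative_tensor_axioms_def V W)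

lemma tensor_module: "module K (tensor K V W)"
  unfolding tensor_eq_tensor_mod by (rule T.T_module)

lemma tens_bilinear: "bilinear_on K V W (tensor K V W) (tens K V W)"
  unfolding tensor_eq_tensor_mod by (rule T.pure_bilinear)

lemma tens_closed: "\<lbrakk>v \<in> carrier V; w \<in> carrier W\<rbrakk> \<Longrightarrow> tens K V W v w \<in> carrier (tensor K V W)"
  unfolding tensor_eq_tensor_mod by (rule T.pure_closed)

lemma tensor_compatible: "T.compatible Z \<beta> \<longleftrightarrow> bilinear_on K V W Z \<beta>"
  unfolding T.compatible_def by simp

lemma tensor_linear_eqI:
  assumes "t \<in> carrier (tensor K V W)" "linear_on K (tensor K V W) Z f" "linear_on K (tensor K V W) Z g"
    and "\<And>v w. \<lbrakk>v \<in> carrier V; w \<in> carrier W\<rbrakk> \<Longrightarrow> f (tens K V W v w) = g (tens K V W v w)"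
  shows "f t = g t"
  using T.linear_on_T_eqI assms unfolding tensor_eq_tensor_mod by blast

lemma tensor_lift_linear:
  assumes "module K Z" "bilinear_on K V W Z \<beta>"
  shows "linear_on K (tensor K V W) Z (tensor_lift K Z \<beta>)"
  using T.compatible_lift_linear assms unfolding tensor_eq_tensor_mod tensor_compatible by blast

lemma tensor_lift_tens:
  assumes "module K Z" "bilinear_on K V W Z \<beta>" "v \<in> carrier V" "w \<in> carrier W"
  shows "tensor_lift K Z \<beta> (tens K V W v w) = \<beta> v w"
  using T.compatible_lift_pure assms unfolding tensor_eq_tensor_mod tensor_compatible by blast

lemma tensor_lift_unique:
  assumes "module K Z" "bilinear_on K V W Z \<beta>" "t \<in> carrier (tensor K V W)"
    and "linear_on K (tensor K V W) Z g"
    and "\<And>v w. \<lbrakk>v \<in> carrier V; w \<in> carrier W\<rbrakk> \<Longrightarrow> \<beta> v w = g (tens K V W v w)"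
  shows "tensor_lift K Z \<beta> t = g t"
  using T.lift_unique assms unfolding tensor_eq_tensor_mod tensor_compatible by blast

lemma bilinear_on_cong:
  assumes "\<And>v w. \<lbrakk>v \<in> carrier V; w \<in> carrier W\<rbrakk> \<Longrightarrow> \<beta> v w = \<gamma> v w"
  shows "bilinear_on K V W Z \<beta> \<longleftrightarrow> bilinear_on K V W Z \<gamma>"
proof -
  have "linear_on K W Z (\<beta> v) \<longleftrightarrow> linear_on K W Z (\<gamma> v)" if "v \<in> carrier V" for v
    using that by (intro linear_on_cong[OF W] assms)
  moreover have "linear_on K V Z (\<lambda>v. \<beta> v w) \<longleftrightarrow> linear_on K V Z (\<lambda>v. \<gamma> v w)" if "w \<in> carrier W" for w
    using that by (intro linear_on_cong[OF V] assms)
  ultimately show ?thesis unfolding bilinear_on_def by blast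
qed

lemma tensor_lift_cong:
  assumes "module K Z" "bilinear_on K V W Z \<gamma>" "t \<in> carrier (tensor K V W)"
    and "\<And>v w. \<lbrakk>v \<in> carrier V; w \<in> carrier W\<rbrakk> \<Longrightarrow> \<beta> v w = \<gamma> v w"
  shows "tensor_lift K Z \<beta> t = tensor_lift K Z \<gamma> t"
  using T.lift_cong[of Z \<beta> \<gamma> t] assms bilinear_on_cong[of \<beta> \<gamma> Z]
  unfolding tensor_eq_tensor_mod tensor_compatible by blast

lemma tensor_lift_parameter_linear:
  assumes "module K X" "module K Z" "t \<in> carrier (tensor K V W)"
    and "\<And>x. x \<in> carrier X \<Longrightarrow> bilinear_on K V W Z (\<beta> x)"
    and "\<And>v w. \<lbrakk>v \<in> carrier V; w \<in> carrier W\<rbrakk> \<Longrightarrow> linear_on K X Z (\<lambda>x. \<beta> x v w)"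
  shows "linear_on K X Z (\<lambda>x. tensor_lift K Z (\<beta> x) t)"
  using T.lift_parameter_linear[of X Z t \<beta>] assms unfolding tensor_eq_tensor_mod tensor_compatible by blast

lemma linear_tensor_lift:
  assumes "module K Z" "module K Z'" "bilinear_on K V W Z \<beta>" "linear_on K Z Z' f"
    and "t \<in> carrier (tensor K V W)"
  shows "f (tensor_lift K Z \<beta> t) = tensor_lift K Z' (\<lambda>v w. f (\<beta> v w)) t"
proof (rule sym, rule tensor_lift_unique[OF assms(2) _ assms(5) linear_on_compose[OF tensor_lift_linear[OF assms(1,3)] assms(4)]])
  show "bilinear_on K V W Z' (\<lambda>v w. f (\<beta> v w))"
    by (rule bilinear_compose_linear[OF assms(3,4)])
qed (simp add: tensor_lift_tens assms)

end

lemma tensor_map: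
  assumes "module K V" "module K W" "module K X" "module K Y" "linear_on K X V f" "linear_on K Y W g"
  shows tensor_map_linear: "linear_on K (tensor K X Y) (tensor K V W) (tensor_map K V W f g)"
    and tensor_map_tens: "\<lbrakk>x \<in> carrier X; y \<in> carrier Y\<rbrakk> \<Longrightarrow>
      tensor_map K V W f g (tens K X Y x y) = tens K V W (f x) (g y)"
proof -
  have b: "bilinear_on K X Y (tensor K V W) (\<lambda>x y. tens K V W (f x) (g y))"
    by (rule bilinear_on_compose[OF tens_bilinear[OF assms(1,2)] assms(5,6)])
  show "linear_on K (tensor K X Y) (tensor K V W) (tensor_map K V W f g)"
    unfolding tensor_map_def using assms b by (intro tensor_lift_linear tensor_module)
  show "\<lbrakk>x \<in> carrier X; y \<in> carrier Y\<rbrakk> \<Longrightarrow> tensor_map K V W f g (tens K X Y x y) = tens K V W (f x) (g y)"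
    unfolding tensor_map_def using assms b by (simp add: tensor_lift_tens tensor_module)
qed

lemma flip_tens:
  assumes "module K V" "module K W" "v \<in> carrier V" "w \<in> carrier W"
  shows "flip K V W (tens K V W v w) = tens K W V w v"
proof -
  have "bilinear_on K V W (tensor K W V) (\<lambda>v w. tens K W V w v)"
    using tens_bilinear[OF assms(2,1)] unfolding bilinear_on_def by simp
  then show ?thesis unfolding flip_def using assms by (simp add: tensor_lift_tens tensor_module)
qed

context
  fixes K :: "('k, 'r) ring_scheme" and U :: "('k, 'u, 'x) module_scheme"
    and V :: "('k, 'v, 's) module_scheme" and W :: "('k, 'w, 't) module_scheme"
  assumes U: "module K U" and V: "module K V" and W: "module K W"
begin

lemma assoc_left_inner:
  assumes "u \<in> carrier U"
  shows "bilinear_on K V W (tensor K (tensor K U V) W) (\<lambda>v w. tens K (tensor K U V) W (tens K U V u v) w)"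
  using assms by (intro bilinear_on_compose[OF tens_bilinear] tensor_module U V W linear_on_id bilinear_on_right[OF tens_bilinear])

lemma assoc_left_bilinear:
  "bilinear_on K U (tensor K V W) (tensor K (tensor K U V) W)
    (\<lambda>u t. tensor_lift K (tensor K (tensor K U V) W) (\<lambda>v w. tens K (tensor K U V) W (tens K U V u v) w) t)"
proof (rule bilinear_onI)
  have Z: "module K (tensor K (tensor K U V) W)" by (intro tensor_module U V W)
  let ?\<beta> = "\<lambda>u v w. tens K (tensor K U V) W (tens K U V u v) w"
  show "linear_on K (tensor K V W) (tensor K (tensor K U V) W) (tensor_lift K (tensor K (tensor K U V) W) (?\<beta> u))"
    if "u \<in> carrier U" for u
    by (rule tensor_lift_linear[OF V W Z assoc_left_inner[OF that]])
  show "linear_on K U (tensor K (tensor K U V) W) (\<lambda>u. tensor_lift K (tensor K (tensor K U V) W) (?\<beta> u) t)"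
    if "t \<in> carrier (tensor K V W)" for t
    by (rule tensor_lift_parameter_linear[OF V W U Z that assoc_left_inner], assumption,
        rule linear_on_bilinear_left[OF tens_bilinear[OF tensor_module[OF U V] W] bilinear_on_left[OF tens_bilinear[OF U V]]])
qed

lemma assoc_left_linear:
  "linear_on K (tensor K U (tensor K V W)) (tensor K (tensor K U V) W) (assoc_left K U V W)"
  unfolding assoc_left_def by (intro tensor_lift_linear assoc_left_bilinear tensor_module U V W)

lemma assoc_left_tens_lift:
  "\<lbrakk>u \<in> carrier U; t \<in> carrier (tensor K V W)\<rbrakk> \<Longrightarrow> assoc_left K U V W (tens K U (tensor K V W) u t) =
    tensor_lift K (tensor K (tensor K U V) W) (\<lambda>v w. tens K (tensor K U V) W (tens K U V u v) w) t"
  unfolding assoc_left_def by (simp add: tensor_lift_tens assoc_left_bilinear tensor_module U V W)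

lemma assoc_left_tens:
  "\<lbrakk>u \<in> carrier U; v \<in> carrier V; w \<in> carrier W\<rbrakk> \<Longrightarrow>
    assoc_left K U V W (tens K U (tensor K V W) u (tens K V W v w)) = tens K (tensor K U V) W (tens K U V u v) w"
  by (simp add: assoc_left_tens_lift tensor_lift_tens assoc_left_inner tensor_module tens_closed U V W)

lemma assoc_right_inner:
  assumes "w \<in> carrier W"
  shows "bilinear_on K U V (tensor K U (tensor K V W)) (\<lambda>u v. tens K U (tensor K V W) u (tens K V W v w))"
  using assms by (intro bilinear_on_compose[OF tens_bilinear] tensor_module U V W linear_on_id bilinear_on_left[OF tens_bilinear])

lemma assoc_right_bilinear:
  "bilinear_on K (tensor K U V) W (tensor K U (tensor K V W))
    (\<lambda>t w. tensor_lift K (tensor K U (tensor K V W)) (\<lambda>u v. tens K U (tensor K V W) u (tens K V W v w)) t)"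
proof (rule bilinear_onI)
  have Z: "module K (tensor K U (tensor K V W))" by (intro tensor_module U V W)
  let ?\<beta> = "\<lambda>w u v. tens K U (tensor K V W) u (tens K V W v w)"
  show "linear_on K W (tensor K U (tensor K V W)) (\<lambda>w. tensor_lift K (tensor K U (tensor K V W)) (?\<beta> w) t)"
    if "t \<in> carrier (tensor K U V)" for t
    by (rule tensor_lift_parameter_linear[OF U V W Z that assoc_right_inner], assumption,
        rule linear_on_bilinear_right[OF tens_bilinear[OF U tensor_module[OF V W]] bilinear_on_right[OF tens_bilinear[OF V W]]])
  show "linear_on K (tensor K U V) (tensor K U (tensor K V W)) (tensor_lift K (tensor K U (tensor K V W)) (?\<beta> w))"
    if "w \<in> carrier W" for w
    by (rule tensor_lift_linear[OF U V Z assoc_right_inner[OF that]])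
qed

lemma assoc_right_linear:
  "linear_on K (tensor K (tensor K U V) W) (tensor K U (tensor K V W)) (assoc_right K U V W)"
  unfolding assoc_right_def by (intro tensor_lift_linear assoc_right_bilinear tensor_module U V W)

lemma assoc_right_tens:
  "\<lbrakk>u \<in> carrier U; v \<in> carrier V; w \<in> carrier W\<rbrakk> \<Longrightarrow>
    assoc_right K U V W (tens K (tensor K U V) W (tens K U V u v) w) = tens K U (tensor K V W) u (tens K V W v w)"
  unfolding assoc_right_def
  by (simp add: tensor_lift_tens assoc_right_inner assoc_right_bilinear tensor_module tens_closed U V W)

end

section \<open>Tensor products over a set of balancing elements\<close>

context unital_algebra
begin

lemma algebra_module: "module K P" ..

lemma mult_bilinear: "bilinear_on K P P P (\<lambda>x y. x \<otimes>\<^bsub>P\<^esub> y)"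
  by (intro bilinear_onI linear_onI) (auto simp: r_distr l_distr smult_mult_left smult_mult_right)

lemma mult_map_linear: "linear_on K (tensor K P P) P (mult_map K P)"
  unfolding mult_map_def by (intro tensor_lift_linear algebra_module mult_bilinear)

lemma mult_map_tens: "\<lbrakk>x \<in> carrier P; y \<in> carrier P\<rbrakk> \<Longrightarrow> mult_map K P (tens K P P x y) = x \<otimes>\<^bsub>P\<^esub> y"
  unfolding mult_map_def by (simp add: tensor_lift_tens algebra_module mult_bilinear)

lemma regular_module: "left_alg_module K P P (\<lambda>u v. u \<otimes>\<^bsub>P\<^esub> v)"
  by (unfold_locales) (auto simp: r_distr l_distr smult_mult_left smult_mult_right m_assoc)

end

lemma tensor_over_eq_tensor_mod:
  "tensor_over K P M = tensor_mod K P P (balanced_relators K P M)"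
  "tens_over K P M = tensor_pure K P P (balanced_relators K P M)"
  by (simp_all add: fun_eq_iff tensor_over_def tensor_mod_def tens_over_def tensor_pure_def)

locale balanced_tensor = unital_algebra K P
  for K :: "('k, 'r) ring_scheme" (structure) and P :: "('k, 'p, 's) module_scheme" (structure) +
  fixes M :: "'p set"
  assumes M_subset: "M \<subseteq> carrier P"
begin

sublocale T: relative_tensor K P P "balanced_relators K P M"
proof
  interpret F: module K "free_module K (carrier P \<times> carrier P)"
    by (rule free_module_module) (rule R.is_cring)
  show "balanced_relators K P M \<subseteq> carrier (free_module K (carrier P \<times> carrier P))"
    unfolding balanced_relators_def Let_def using M_subset
    by (auto intro!: F.M.minus_closed single_carrier R.is_cring)
qed

definition balanced :: "('k, 'z, 'q) module_scheme \<Rightarrow> ('p \<Rightarrow> 'p \<Rightarrow> 'z) \<Rightarrow> bool"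
  where "balanced Z \<beta> \<longleftrightarrow> bilinear_on K P P Z \<beta> \<and>
    (\<forall>u\<in>carrier P. \<forall>m\<in>M. \<forall>v\<in>carrier P. \<beta> (u \<otimes>\<^bsub>P\<^esub> m) v = \<beta> u (m \<otimes>\<^bsub>P\<^esub> v))"

lemma balancedI:
  assumes "bilinear_on K P P Z \<beta>"
    and "\<And>u m v. \<lbrakk>u \<in> carrier P; m \<in> M; v \<in> carrier P\<rbrakk> \<Longrightarrow> \<beta> (u \<otimes>\<^bsub>P\<^esub> m) v = \<beta> u (m \<otimes>\<^bsub>P\<^esub> v)"
  shows "balanced Z \<beta>"
  using assms unfolding balanced_def by blast

lemma balanced_compatible:
  assumes Z: "module K Z" and "balanced Z \<beta>"
  shows "T.compatible Z \<beta>"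
proof -
  interpret Z: module K Z by fact
  have \<beta>: "bilinear_on K P P Z \<beta>"
    and bal: "\<And>u m v. \<lbrakk>u \<in> carrier P; m \<in> M; v \<in> carrier P\<rbrakk> \<Longrightarrow> \<beta> (u \<otimes>\<^bsub>P\<^esub> m) v = \<beta> u (m \<otimes>\<^bsub>P\<^esub> v)"
    using assms(2) unfolding balanced_def by auto
  have cl: "\<beta> v w \<in> carrier Z" if "v \<in> carrier P" "w \<in> carrier P" for v w
    using linear_on_closed[OF bilinear_on_right[OF \<beta>]] that by blast
  have h: "(\<lambda>(v, w). \<beta> v w) \<in> carrier P \<times> carrier P \<rightarrow> carrier Z" using cl by auto
  note L = linear_extension_linear[OF Z h]
  have L1: "linear_extension K Z (\<lambda>(v, w). \<beta> v w) (single K (v, w)) = \<beta> v w"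
    if "v \<in> carrier P" "w \<in> carrier P" for v w using L(2)[of "(v, w)"] that by simp
  have "linear_extension K Z (\<lambda>(v, w). \<beta> v w) r = \<zero>\<^bsub>Z\<^esub>" if r: "r \<in> balanced_relators K P M" for r
  proof -
    obtain u m v where umv: "u \<in> carrier P" "m \<in> M" "v \<in> carrier P"
      and r: "r = single K (u \<otimes>\<^bsub>P\<^esub> m, v) \<ominus>\<^bsub>T.F\<^esub> single K (u, m \<otimes>\<^bsub>P\<^esub> v)"
      using r unfolding balanced_relators_def Let_def by auto
    have m: "m \<in> carrier P" using umv M_subset by auto
    have "linear_extension K Z (\<lambda>(v, w). \<beta> v w) r = \<beta> (u \<otimes>\<^bsub>P\<^esub> m) v \<ominus>\<^bsub>Z\<^esub> \<beta> u (m \<otimes>\<^bsub>P\<^esub> v)"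
      unfolding r using umv m by (subst linear_on_diff[OF T.F.module_axioms Z L(1)]) (simp_all add: T.single_F L1)
    also have "\<dots> = \<zero>\<^bsub>Z\<^esub>" using bal[OF umv] cl[of u "m \<otimes>\<^bsub>P\<^esub> v"] umv m by (simp add: a_minus_def Z.r_neg)
    finally show ?thesis .
  qed
  then show ?thesis unfolding T.compatible_def using \<beta> by blast
qed

abbreviation "W \<equiv> tensor_over K P M"
abbreviation "pure_over \<equiv> tens_over K P M"

lemma over_module: "module K W"
  unfolding tensor_over_eq_tensor_mod by (rule T.T_module)

lemma pure_over_bilinear: "bilinear_on K P P W pure_over"
  unfolding tensor_over_eq_tensor_mod by (rule T.pure_bilinear)

lemma pure_over_closed: "\<lbrakk>u \<in> carrier P; v \<in> carrier P\<rbrakk> \<Longrightarrow> pure_over u v \<in> carrier W"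
  unfolding tensor_over_eq_tensor_mod by (rule T.pure_closed)

lemma pure_over_balanced: "\<lbrakk>u \<in> carrier P; m \<in> M; v \<in> carrier P\<rbrakk> \<Longrightarrow> pure_over (u \<otimes>\<^bsub>P\<^esub> m) v = pure_over u (m \<otimes>\<^bsub>P\<^esub> v)"
  unfolding tensor_over_eq_tensor_mod using M_subset
  by (intro T.pure_relator) (auto simp: balanced_relators_def Let_def)

lemma over_linear_eqI:
  assumes "w \<in> carrier W" "linear_on K W Z f" "linear_on K W Z g"
    and "\<And>u v. \<lbrakk>u \<in> carrier P; v \<in> carrier P\<rbrakk> \<Longrightarrow> f (pure_over u v) = g (pure_over u v)"
  shows "f w = g w"
  using T.linear_on_T_eqI assms unfolding tensor_over_eq_tensor_mod by blast

lemma over_lift_linear: "\<lbrakk>module K Z; balanced Z \<beta>\<rbrakk> \<Longrightarrow> linear_on K W Z (tensor_lift K Z \<beta>)"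
  unfolding tensor_over_eq_tensor_mod by (intro T.compatible_lift_linear balanced_compatible)

lemma over_lift_pure:
  "\<lbrakk>module K Z; balanced Z \<beta>; u \<in> carrier P; v \<in> carrier P\<rbrakk> \<Longrightarrow> tensor_lift K Z \<beta> (pure_over u v) = \<beta> u v"
  unfolding tensor_over_eq_tensor_mod by (intro T.compatible_lift_pure balanced_compatible)

lemma over_lift_cong:
  assumes "module K Z" "balanced Z \<gamma>" "w \<in> carrier W"
    and "\<And>u v. \<lbrakk>u \<in> carrier P; v \<in> carrier P\<rbrakk> \<Longrightarrow> \<beta> u v = \<gamma> u v"
  shows "tensor_lift K Z \<beta> w = tensor_lift K Z \<gamma> w"
proof -
  have "bilinear_on K P P Z \<beta>"
    using bilinear_on_cong[OF algebra_module algebra_module, of \<beta> \<gamma> Z] assms(2,4) unfolding balanced_def by blast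
  then have "balanced Z \<beta>" using assms(2,4) M_subset unfolding balanced_def by (auto simp: subsetD)
  then show ?thesis
    using T.lift_cong[of Z \<beta> \<gamma> w] balanced_compatible assms unfolding tensor_over_eq_tensor_mod by blast
qed

lemma over_lift_parameter_linear:
  assumes "module K X" "module K Z" "w \<in> carrier W"
    and "\<And>x. x \<in> carrier X \<Longrightarrow> balanced Z (\<beta> x)"
    and "\<And>u v. \<lbrakk>u \<in> carrier P; v \<in> carrier P\<rbrakk> \<Longrightarrow> linear_on K X Z (\<lambda>x. \<beta> x u v)"
  shows "linear_on K X Z (\<lambda>x. tensor_lift K Z (\<beta> x) w)"
  using T.lift_parameter_linear[of X Z w \<beta>] assms balanced_compatible[OF assms(2)]
  unfolding tensor_over_eq_tensor_mod by blast

end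

section \<open>Algebra actions, their invariants and the map chi\<close>

text \<open>
  The usual congruence rule for finite sums asks for summands in the carrier. This one applies
  directly to partial traces, whose summands could only be shown to lie in the carrier by way of the
  linearity of the coordinate functionals.
\<close>

lemma finsum_cong_pointwise:
  fixes f g :: "'b \<Rightarrow> 'c"
  assumes "\<And>x. x \<in> B \<Longrightarrow> f x = g x"
  shows "finsum G f B = finsum G g B"
proof -
  have imp: "(C, x) \<in> foldSetD D (h \<circ> f') e \<Longrightarrow> (\<And>y. y \<in> C \<Longrightarrow> f' y = g' y) \<Longrightarrow> (C, x) \<in> foldSetD D (h \<circ> g') e"
    for C D and e x :: 'c and h and f' g' :: "'b \<Rightarrow> 'c"
  proof (induction C x rule: foldSetD.induct)
    case (insertI x A y)
    have "(A, y) \<in> foldSetD D (h \<circ> g') e" using insertI.IH insertI.prems by blast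
    moreover have "(h \<circ> g') x y \<in> D" using insertI.hyps(2) insertI.prems[of x] by simp
    ultimately have "(insert x A, (h \<circ> g') x y) \<in> foldSetD D (h \<circ> g') e"
      using insertI.hyps(1) by (intro foldSetD.insertI)
    then show ?case using insertI.prems[of x] by (simp add: comp_def)
  qed (simp add: foldSetD.emptyI)
  have "(B, x) \<in> foldSetD D (h \<circ> f) e \<longleftrightarrow> (B, x) \<in> foldSetD D (h \<circ> g) e" for D and e x :: 'c and h
    using imp[of B x D h f e g] imp[of B x D h g e f] assms by auto
  then show ?thesis unfolding finsum_def finprod_def foldD_def by simp
qed

locale algebra_action = left_alg_module K A P act + P: unital_algebra K P
  for K :: "('k, 'r) ring_scheme" (structure)
    and A :: "('k, 'a, 's) module_scheme" (structure)
    and P :: "('k, 'p, 't) module_scheme" (structure)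
    and act :: "'a \<Rightarrow> 'p \<Rightarrow> 'p"
begin

definition invariants :: "'p set"
  where "invariants = {m \<in> carrier P. \<forall>u\<in>carrier P. \<forall>a\<in>carrier A. act a (u \<otimes>\<^bsub>P\<^esub> m) = act a u \<otimes>\<^bsub>P\<^esub> m}"

sublocale balanced_tensor K P invariants
  by unfold_locales (auto simp: invariants_def)

lemma invariantsD:
  "\<lbrakk>m \<in> invariants; u \<in> carrier P; a \<in> carrier A\<rbrakk> \<Longrightarrow> act a (u \<otimes>\<^bsub>P\<^esub> m) = act a u \<otimes>\<^bsub>P\<^esub> m"
  "m \<in> invariants \<Longrightarrow> m \<in> carrier P"
  by (auto simp: invariants_def)

lemmas modules [simp] = A.algebra_module P.algebra_module over_module tensor_module
declare tens_closed [simp] pure_over_closed [simp] act_closed [simp]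

lemma act_bilinear: "bilinear_on K A P P act"
  by (intro bilinear_onI linear_onI) (auto simp: act_add_left act_add_right act_smult_left act_smult_right)

lemma tensor_act_bilinear: "v \<in> carrier P \<Longrightarrow> bilinear_on K P A P (\<lambda>x a. x \<otimes>\<^bsub>P\<^esub> act a v)"
  using bilinear_on_compose[OF P.mult_bilinear linear_on_id bilinear_on_left[OF act_bilinear]] .

text \<open>
  The operator on \<open>P\<close> given by an element of \<open>P \<otimes> A\<close>; for \<open>\<Psi>\<close>-modules it is the action of the
  factorised algebra on \<open>P\<close>.
\<close>

definition tensor_act :: "('p \<times> 'a \<Rightarrow> 'k) set \<Rightarrow> 'p \<Rightarrow> 'p"
  where "tensor_act t v = tensor_lift K P (\<lambda>x a. x \<otimes>\<^bsub>P\<^esub> act a v) t"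

lemma tensor_act_linear: "v \<in> carrier P \<Longrightarrow> linear_on K (tensor K P A) P (\<lambda>t. tensor_act t v)"
  unfolding tensor_act_def by (intro tensor_lift_linear tensor_act_bilinear modules)

lemma tensor_act_tens [simp]:
  "\<lbrakk>x \<in> carrier P; a \<in> carrier A; v \<in> carrier P\<rbrakk> \<Longrightarrow> tensor_act (tens K P A x a) v = x \<otimes>\<^bsub>P\<^esub> act a v"
  unfolding tensor_act_def by (simp add: tensor_lift_tens tensor_act_bilinear)

lemma tensor_act_linear_right:
  assumes "t \<in> carrier (tensor K P A)"
  shows "linear_on K P P (tensor_act t)"
  unfolding tensor_act_def
  by (rule tensor_lift_parameter_linear[OF _ _ _ _ assms tensor_act_bilinear])
    (auto intro: linear_on_bilinear_right[OF P.mult_bilinear] bilinear_on_right[OF act_bilinear])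

lemma tensor_act_closed [simp]: "\<lbrakk>t \<in> carrier (tensor K P A); v \<in> carrier P\<rbrakk> \<Longrightarrow> tensor_act t v \<in> carrier P"
  using linear_on_closed[OF tensor_act_linear] by blast

text \<open>
  These operators commute with right multiplication by \<open>M\<close>, because each \<open>a \<triangleright> _\<close> does. This makes
  \<open>p \<otimes> q \<mapsto> T(p) q\<close> well-defined on \<open>P \<otimes>\<^sub>M P\<close>.
\<close>

lemma tensor_act_invariant:
  assumes "t \<in> carrier (tensor K P A)" "m \<in> invariants" "v \<in> carrier P"
  shows "tensor_act t (v \<otimes>\<^bsub>P\<^esub> m) = tensor_act t v \<otimes>\<^bsub>P\<^esub> m"
proof (rule tensor_linear_eqI[OF _ _ assms(1)])
  show "linear_on K (tensor K P A) P (\<lambda>t. tensor_act t (v \<otimes>\<^bsub>P\<^esub> m))"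
    using assms invariantsD by (intro tensor_act_linear) auto
  show "linear_on K (tensor K P A) P (\<lambda>t. tensor_act t v \<otimes>\<^bsub>P\<^esub> m)"
    using assms invariantsD by (intro linear_on_bilinear_left[OF P.mult_bilinear] tensor_act_linear) auto
qed (use assms invariantsD in \<open>auto simp: P.m_assoc\<close>)

lemma tensor_act_balanced:
  assumes "t \<in> carrier (tensor K P A)"
  shows "balanced P (\<lambda>p q. tensor_act t p \<otimes>\<^bsub>P\<^esub> q)"
  using bilinear_on_compose[OF P.mult_bilinear tensor_act_linear_right[OF assms] linear_on_id] assms invariantsD
  by (intro balancedI) (auto simp: P.m_assoc tensor_act_invariant)

lemma chi_inner_balanced: "a \<in> carrier A \<Longrightarrow> balanced P (\<lambda>u v. act a u \<otimes>\<^bsub>P\<^esub> v)"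
  using bilinear_on_compose[OF P.mult_bilinear bilinear_on_right[OF act_bilinear] linear_on_id] invariantsD
  by (intro balancedI) (auto simp: P.m_assoc)

lemma chi_bilinear: "bilinear_on K A W P (\<lambda>a. tensor_lift K P (\<lambda>u v. act a u \<otimes>\<^bsub>P\<^esub> v))"
proof (rule bilinear_onI)
  show "linear_on K W P (tensor_lift K P (\<lambda>u v. act a u \<otimes>\<^bsub>P\<^esub> v))" if "a \<in> carrier A" for a
    using that by (intro over_lift_linear chi_inner_balanced modules)
  show "linear_on K A P (\<lambda>a. tensor_lift K P (\<lambda>u v. act a u \<otimes>\<^bsub>P\<^esub> v) w)" if "w \<in> carrier W" for w
    by (rule over_lift_parameter_linear[OF _ _ that chi_inner_balanced])
      (auto intro: linear_on_bilinear_left[OF P.mult_bilinear] bilinear_on_left[OF act_bilinear])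
qed

lemma chi_linear: "linear_on K (tensor K A W) P (chi K P act)"
  unfolding chi_def by (intro tensor_lift_linear chi_bilinear modules)

lemma chi_tens_lift:
  "\<lbrakk>a \<in> carrier A; w \<in> carrier W\<rbrakk> \<Longrightarrow> chi K P act (tens K A W a w) = tensor_lift K P (\<lambda>u v. act a u \<otimes>\<^bsub>P\<^esub> v) w"
  unfolding chi_def by (simp add: tensor_lift_tens chi_bilinear)

lemma chi_tens [simp]:
  "\<lbrakk>a \<in> carrier A; u \<in> carrier P; v \<in> carrier P\<rbrakk> \<Longrightarrow> chi K P act (tens K A W a (pure_over u v)) = act a u \<otimes>\<^bsub>P\<^esub> v"
  by (simp add: chi_tens_lift over_lift_pure chi_inner_balanced)

lemma chi_closed [simp]: "x \<in> carrier (tensor K A W) \<Longrightarrow> chi K P act x \<in> carrier P"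
  using linear_on_closed[OF chi_linear] .

lemma chi_tens_linear: "a \<in> carrier A \<Longrightarrow> linear_on K W P (\<lambda>w. chi K P act (tens K A W a w))"
  by (rule linear_on_compose[OF bilinear_on_right[OF tens_bilinear] chi_linear]) auto

lemma left_mult_balanced: "u \<in> carrier P \<Longrightarrow> balanced W (\<lambda>p q. pure_over (u \<otimes>\<^bsub>P\<^esub> p) q)"
  using bilinear_on_compose[OF pure_over_bilinear bilinear_on_right[OF P.mult_bilinear] linear_on_id] invariantsD
  by (intro balancedI) (auto simp flip: P.m_assoc pure_over_balanced)

abbreviation "lmul \<equiv> left_mult_over K P invariants"

lemma lmul_linear: "u \<in> carrier P \<Longrightarrow> linear_on K W W (lmul u)"
  unfolding left_mult_over_def by (intro over_lift_linear left_mult_balanced modules)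

lemma lmul_pure [simp]:
  "\<lbrakk>u \<in> carrier P; p \<in> carrier P; q \<in> carrier P\<rbrakk> \<Longrightarrow> lmul u (pure_over p q) = pure_over (u \<otimes>\<^bsub>P\<^esub> p) q"
  unfolding left_mult_over_def by (simp add: over_lift_pure left_mult_balanced)

lemma lmul_linear_left: "w \<in> carrier W \<Longrightarrow> linear_on K P W (\<lambda>u. lmul u w)"
  unfolding left_mult_over_def
  by (rule over_lift_parameter_linear[OF _ _ _ left_mult_balanced])
    (auto intro: linear_on_bilinear_left[OF pure_over_bilinear] bilinear_on_left[OF P.mult_bilinear])

lemma lmul_closed [simp]: "\<lbrakk>u \<in> carrier P; w \<in> carrier W\<rbrakk> \<Longrightarrow> lmul u w \<in> carrier W"
  using linear_on_closed[OF lmul_linear] .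

text \<open>
  Right multiplication on the right factor of \<open>P \<otimes>\<^sub>M P\<close>. It commutes with left multiplication on the
  left factor, and \<open>\<chi>(a \<otimes> _)\<close> intertwines it with right multiplication in \<open>P\<close>.
\<close>

definition rmul :: "'p \<Rightarrow> ('p \<times> 'p \<Rightarrow> 'k) set \<Rightarrow> ('p \<times> 'p \<Rightarrow> 'k) set"
  where "rmul y = tensor_lift K W (\<lambda>p q. pure_over p (q \<otimes>\<^bsub>P\<^esub> y))"

lemma right_mult_balanced: "y \<in> carrier P \<Longrightarrow> balanced W (\<lambda>p q. pure_over p (q \<otimes>\<^bsub>P\<^esub> y))"
  using bilinear_on_compose[OF pure_over_bilinear linear_on_id bilinear_on_left[OF P.mult_bilinear]] invariantsD
  by (intro balancedI) (auto simp: P.m_assoc pure_over_balanced)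

lemma rmul_linear: "y \<in> carrier P \<Longrightarrow> linear_on K W W (rmul y)"
  unfolding rmul_def by (intro over_lift_linear right_mult_balanced modules)

lemma rmul_pure [simp]:
  "\<lbrakk>y \<in> carrier P; p \<in> carrier P; q \<in> carrier P\<rbrakk> \<Longrightarrow> rmul y (pure_over p q) = pure_over p (q \<otimes>\<^bsub>P\<^esub> y)"
  unfolding rmul_def by (simp add: over_lift_pure right_mult_balanced)

lemma rmul_linear_left: "w \<in> carrier W \<Longrightarrow> linear_on K P W (\<lambda>y. rmul y w)"
  unfolding rmul_def
  by (rule over_lift_parameter_linear[OF _ _ _ right_mult_balanced])
    (auto intro: linear_on_bilinear_right[OF pure_over_bilinear] bilinear_on_right[OF P.mult_bilinear])

lemma rmul_closed [simp]: "\<lbrakk>y \<in> carrier P; w \<in> carrier W\<rbrakk> \<Longrightarrow> rmul y w \<in> carrier W"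
  using linear_on_closed[OF rmul_linear] .

lemma rmul_act_bilinear:
  "v \<in> carrier P \<Longrightarrow> bilinear_on K W A W (\<lambda>w c. rmul (act c v) w)"
  by (intro bilinear_onI rmul_linear act_closed
      linear_on_compose[OF bilinear_on_left[OF act_bilinear] rmul_linear_left])

lemma lmul_rmul:
  assumes "u \<in> carrier P" "y \<in> carrier P" "w \<in> carrier W"
  shows "lmul u (rmul y w) = rmul y (lmul u w)"
  by (rule over_linear_eqI[OF assms(3) linear_on_compose[OF rmul_linear lmul_linear] linear_on_compose[OF lmul_linear rmul_linear]])
    (use assms in auto)

lemma chi_rmul:
  assumes "a \<in> carrier A" "y \<in> carrier P" "w \<in> carrier W"
  shows "chi K P act (tens K A W a (rmul y w)) = chi K P act (tens K A W a w) \<otimes>\<^bsub>P\<^esub> y"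
  by (rule over_linear_eqI[OF assms(3) linear_on_compose[OF rmul_linear chi_tens_linear]
        linear_on_bilinear_left[OF P.mult_bilinear chi_tens_linear]])
    (use assms in \<open>auto simp: P.m_assoc\<close>)

end

section \<open>Elements of P tensor A as operators on P\<close>

locale galois_action = algebra_action K A P act
  for K :: "('k, 'r) ring_scheme" (structure)
    and A :: "('k, 'a, 's) module_scheme" (structure)
    and P :: "('k, 'p, 't) module_scheme" (structure)
    and act :: "'a \<Rightarrow> 'p \<Rightarrow> 'p" +
  fixes cs :: "'p \<Rightarrow> (('p \<times> 'p \<Rightarrow> 'k) set \<times> 'a \<Rightarrow> 'k) set"
  assumes finite_dim_A: "finite_dim K A"
    and galois: "galois_map K P A invariants act cs"
begin

lemma galois_facts:
  shows cs_linear: "linear_on K P (tensor K W A) cs"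
    and trace_cs_chi: "x \<in> carrier W \<Longrightarrow> partial_trace K A W (cs \<circ> chi K P act) x = x"
    and chi_cs: "y \<in> carrier (tensor K A P) \<Longrightarrow>
      tensor_map K P A (chi K P act) id
        (assoc_left K A W A (tensor_map K A (tensor K W A) id cs y)) = flip K A P y"
  using galois unfolding galois_map_def Let_def by (auto intro: linear_on_linear_maps)

lemma chosen_basis_closed: "e \<in> (SOME E. finite_basis K A E) \<Longrightarrow> e \<in> carrier A"
  using someI_ex[OF finite_dim_A[unfolded finite_dim_def]] unfolding finite_basis_def by auto

text \<open>
  The partial trace of \<open>\<chi>\<^sup># \<circ> \<chi>\<close> at \<open>x\<close> is computed from the elements \<open>\<chi>(e \<otimes> x)\<close>, with \<open>e\<close> in a basis of
  \<open>A\<close>, and returns \<open>x\<close>. So these elements determine \<open>x\<close>.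
\<close>

lemma chi_eqI:
  assumes "x \<in> carrier W" "y \<in> carrier W"
    and "\<And>a. a \<in> carrier A \<Longrightarrow> chi K P act (tens K A W a x) = chi K P act (tens K A W a y)"
  shows "x = y"
proof -
  have "partial_trace K A W (cs \<circ> chi K P act) x = partial_trace K A W (cs \<circ> chi K P act) y"
    unfolding partial_trace_def Let_def by (rule finsum_cong_pointwise) (simp add: assms(3) chosen_basis_closed)
  then show ?thesis using trace_cs_chi assms(1,2) by simp
qed

abbreviation "cs_one \<equiv> cs \<one>\<^bsub>P\<^esub>"

lemma cs_one_closed [simp]: "cs_one \<in> carrier (tensor K W A)"
  using linear_on_closed[OF cs_linear] by simp

lemma chi_tens_bilinear: "a \<in> carrier A \<Longrightarrow>
    bilinear_on K W A (tensor K P A) (\<lambda>w c. tens K P A (chi K P act (tens K A W a w)) c)"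
  by (intro bilinear_on_compose[OF tens_bilinear] chi_tens_linear linear_on_id modules)

text \<open>
  The identity \<open>(\<chi> \<otimes> id)(id \<otimes> \<chi>\<^sup>#) = \<tau>\<close>, evaluated at \<open>a \<otimes> 1\<close>.
\<close>

lemma chi_cs_one:
  assumes a: "a \<in> carrier A"
  shows "tensor_lift K (tensor K P A) (\<lambda>w c. tens K P A (chi K P act (tens K A W a w)) c) cs_one = tens K P A \<one>\<^bsub>P\<^esub> a"
proof -
  have lin: "linear_on K (tensor K (tensor K A W) A) (tensor K P A) (tensor_map K P A (chi K P act) id)"
    by (intro tensor_map_linear chi_linear linear_on_id_const modules)
  have "tens K P A \<one>\<^bsub>P\<^esub> a = flip K A P (tens K A P a \<one>\<^bsub>P\<^esub>)"
    using a by (simp add: flip_tens)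
  also have "\<dots> = tensor_map K P A (chi K P act) id
        (assoc_left K A W A (tensor_map K A (tensor K W A) id cs (tens K A P a \<one>\<^bsub>P\<^esub>)))"
    using a by (simp add: chi_cs)
  also have "tensor_map K A (tensor K W A) id cs (tens K A P a \<one>\<^bsub>P\<^esub>) = tens K A (tensor K W A) a cs_one"
    using a by (simp add: tensor_map_tens linear_on_id_const cs_linear)
  also have "assoc_left K A W A \<dots> =
      tensor_lift K (tensor K (tensor K A W) A) (\<lambda>w c. tens K (tensor K A W) A (tens K A W a w) c) cs_one"
    using a by (simp add: assoc_left_tens_lift)
  also have "tensor_map K P A (chi K P act) id \<dots> =
      tensor_lift K (tensor K P A) (\<lambda>w c. tensor_map K P A (chi K P act) id (tens K (tensor K A W) A (tens K A W a w) c)) cs_one"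
    using a by (intro linear_tensor_lift[OF over_module A.algebra_module _ _ assoc_left_inner] lin modules cs_one_closed)
  also have "\<dots> = tensor_lift K (tensor K P A) (\<lambda>w c. tens K P A (chi K P act (tens K A W a w)) c) cs_one"
    using a by (intro tensor_lift_cong[OF over_module A.algebra_module] modules chi_tens_bilinear cs_one_closed) (simp_all add: tensor_map_tens linear_on_id_const chi_linear)
  finally show ?thesis by simp
qed

text \<open>
  Inversion formula for \<open>tensor_act\<close>. On \<open>t = x \<otimes> a\<close> the inner lift is \<open>x \<chi>(a \<otimes> w)\<close>, and \<open>chi_cs_one\<close>
  multiplied by \<open>x\<close> from the left returns \<open>x \<otimes> a\<close>.
\<close>

lemma recover_from_tensor_act:
  assumes t: "t \<in> carrier (tensor K P A)"
  shows "tensor_lift K (tensor K P A)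
    (\<lambda>w c. tens K P A (tensor_lift K P (\<lambda>p q. tensor_act t p \<otimes>\<^bsub>P\<^esub> q) w) c) cs_one = t"
proof -
  note bal = tensor_act_balanced
  have bil: "bilinear_on K W A (tensor K P A) (\<lambda>w c. tens K P A (tensor_lift K P (\<lambda>p q. tensor_act t p \<otimes>\<^bsub>P\<^esub> q) w) c)"
    if "t \<in> carrier (tensor K P A)" for t
    by (intro bilinear_on_compose[OF tens_bilinear] over_lift_linear bal that linear_on_id modules)
  have lin: "linear_on K (tensor K P A) (tensor K P A) (\<lambda>t. tensor_lift K (tensor K P A)
    (\<lambda>w c. tens K P A (tensor_lift K P (\<lambda>p q. tensor_act t p \<otimes>\<^bsub>P\<^esub> q) w) c) cs_one)"
  proof (rule tensor_lift_parameter_linear[OF over_module A.algebra_module _ _ cs_one_closed bil])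
    fix w c assume wc: "w \<in> carrier W" "c \<in> carrier A"
    have "linear_on K (tensor K P A) P (\<lambda>t. tensor_lift K P (\<lambda>p q. tensor_act t p \<otimes>\<^bsub>P\<^esub> q) w)"
      by (rule over_lift_parameter_linear[OF _ _ wc(1) bal])
        (auto intro: linear_on_bilinear_left[OF P.mult_bilinear] tensor_act_linear)
    then show "linear_on K (tensor K P A) (tensor K P A)
        (\<lambda>t. tens K P A (tensor_lift K P (\<lambda>p q. tensor_act t p \<otimes>\<^bsub>P\<^esub> q) w) c)"
      by (rule linear_on_bilinear_left[OF tens_bilinear[OF P.algebra_module A.algebra_module] _ wc(2)])
  qed simp_all
  show ?thesis
  proof (rule tensor_linear_eqI[OF _ _ t lin linear_on_id])
    fix x a assume x: "x \<in> carrier P" and a: "a \<in> carrier A"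
    \<comment> \<open>left multiplication by \<open>x\<close> on the factor \<open>P\<close> of \<open>P \<otimes> A\<close>\<close>
    define L where "L = tensor_map K P A (\<lambda>y. x \<otimes>\<^bsub>P\<^esub> y) (\<lambda>b. b)"
    have L: "linear_on K (tensor K P A) (tensor K P A) L"
      unfolding L_def by (intro tensor_map_linear linear_on_id bilinear_on_right[OF P.mult_bilinear] x modules)
    have L_tens: "L (tens K P A y b) = tens K P A (x \<otimes>\<^bsub>P\<^esub> y) b" if "y \<in> carrier P" "b \<in> carrier A" for y b
      unfolding L_def using that x
      by (simp add: tensor_map_tens linear_on_id bilinear_on_right[OF P.mult_bilinear])
    have inner: "tensor_lift K P (\<lambda>p q. tensor_act (tens K P A x a) p \<otimes>\<^bsub>P\<^esub> q) w = x \<otimes>\<^bsub>P\<^esub> chi K P act (tens K A W a w)"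
      if w: "w \<in> carrier W" for w
      by (rule over_linear_eqI[OF w over_lift_linear[OF _ bal]
            linear_on_bilinear_right[OF P.mult_bilinear chi_tens_linear]])
        (use x a in \<open>auto simp: over_lift_pure bal P.m_assoc\<close>)
    have "tensor_lift K (tensor K P A)
        (\<lambda>w c. tens K P A (tensor_lift K P (\<lambda>p q. tensor_act (tens K P A x a) p \<otimes>\<^bsub>P\<^esub> q) w) c) cs_one =
      tensor_lift K (tensor K P A) (\<lambda>w c. L (tens K P A (chi K P act (tens K A W a w)) c)) cs_one"
      by (rule tensor_lift_cong[OF over_module A.algebra_module _ bilinear_compose_linear[OF chi_tens_bilinear L] cs_one_closed])
        (use x a in \<open>simp_all add: inner L_tens\<close>)
    also have "\<dots> = L (tensor_lift K (tensor K P A) (\<lambda>w c. tens K P A (chi K P act (tens K A W a w)) c) cs_one)"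
      by (rule linear_tensor_lift[OF over_module A.algebra_module _ _ chi_tens_bilinear L cs_one_closed, symmetric])
        (use a in simp_all)
    also have "\<dots> = tens K P A x a"
      using x a by (simp add: chi_cs_one L_tens)
    finally show "tensor_lift K (tensor K P A)
        (\<lambda>w c. tens K P A (tensor_lift K P (\<lambda>p q. tensor_act (tens K P A x a) p \<otimes>\<^bsub>P\<^esub> q) w) c) cs_one = tens K P A x a" .
  qed simp_all
qed

lemma tensor_act_eqI:
  assumes s: "s \<in> carrier (tensor K P A)" and t: "t \<in> carrier (tensor K P A)"
    and eq: "\<And>v. v \<in> carrier P \<Longrightarrow> tensor_act s v = tensor_act t v"
  shows "s = t"
proof -
  note bal = tensor_act_balanced[OF t]
  have "tensor_lift K P (\<lambda>p q. tensor_act s p \<otimes>\<^bsub>P\<^esub> q) w = tensor_lift K P (\<lambda>p q. tensor_act t p \<otimes>\<^bsub>P\<^esub> q) w"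
    if "w \<in> carrier W" for w
    by (rule over_lift_cong[OF _ bal that]) (simp_all add: eq)
  moreover have "bilinear_on K W A (tensor K P A) (\<lambda>w c. tens K P A (tensor_lift K P (\<lambda>p q. tensor_act t p \<otimes>\<^bsub>P\<^esub> q) w) c)"
    by (intro bilinear_on_compose[OF tens_bilinear] over_lift_linear bal linear_on_id modules)
  ultimately have "tensor_lift K (tensor K P A)
      (\<lambda>w c. tens K P A (tensor_lift K P (\<lambda>p q. tensor_act s p \<otimes>\<^bsub>P\<^esub> q) w) c) cs_one =
    tensor_lift K (tensor K P A)
      (\<lambda>w c. tens K P A (tensor_lift K P (\<lambda>p q. tensor_act t p \<otimes>\<^bsub>P\<^esub> q) w) c) cs_one"
    by (intro tensor_lift_cong[OF over_module A.algebra_module] modules cs_one_closed) simp_all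
  then show ?thesis using recover_from_tensor_act s t by simp
qed

section \<open>The factorisation map of a Galois action\<close>

text \<open>
  The inversion formula applied to the operator \<open>v \<mapsto> a \<triangleright> (u v)\<close>, for which the inner lift becomes
  \<open>\<chi>(a \<otimes> u w)\<close>.
\<close>

definition galois_psi :: "'a \<Rightarrow> 'p \<Rightarrow> ('p \<times> 'a \<Rightarrow> 'k) set"
  where "galois_psi a u = tensor_lift K (tensor K P A) (\<lambda>w c. tens K P A (chi K P act (tens K A W a (lmul u w))) c) cs_one"

lemma galois_psi_inner:
  "\<lbrakk>a \<in> carrier A; u \<in> carrier P\<rbrakk> \<Longrightarrow>
    bilinear_on K W A (tensor K P A) (\<lambda>w c. tens K P A (chi K P act (tens K A W a (lmul u w))) c)"
  by (intro bilinear_on_compose[OF tens_bilinear] linear_on_compose[OF lmul_linear chi_tens_linear] linear_on_id modules)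

lemma galois_psi_bilinear: "bilinear_on K A P (tensor K P A) galois_psi"
proof (rule bilinear_onI)
  show "linear_on K P (tensor K P A) (galois_psi a)" if a: "a \<in> carrier A" for a
    unfolding galois_psi_def
  proof (rule tensor_lift_parameter_linear[OF over_module A.algebra_module _ _ cs_one_closed galois_psi_inner[OF a]])
    show "linear_on K P (tensor K P A) (\<lambda>u. tens K P A (chi K P act (tens K A W a (lmul u w))) c)"
      if "w \<in> carrier W" "c \<in> carrier A" for w c
      using that a
      by (intro linear_on_bilinear_left[OF tens_bilinear] linear_on_compose[OF lmul_linear_left chi_tens_linear] modules)
  qed simp_all
  show "linear_on K A (tensor K P A) (\<lambda>a. galois_psi a u)" if u: "u \<in> carrier P" for u
    unfolding galois_psi_def
  proof (rule tensor_lift_parameter_linear[OF over_module A.algebra_module _ _ cs_one_closed galois_psi_inner[OF _ u]])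
    show "linear_on K A (tensor K P A) (\<lambda>a. tens K P A (chi K P act (tens K A W a (lmul u w))) c)"
      if "w \<in> carrier W" "c \<in> carrier A" for w c
      using that u
      by (intro linear_on_bilinear_left[OF tens_bilinear] linear_on_compose[OF bilinear_on_left[OF tens_bilinear] chi_linear] modules lmul_closed)
  qed simp_all
qed

lemma galois_psi_closed: "\<lbrakk>a \<in> carrier A; u \<in> carrier P\<rbrakk> \<Longrightarrow> galois_psi a u \<in> carrier (tensor K P A)"
  using linear_on_closed[OF bilinear_on_right[OF galois_psi_bilinear]] .

text \<open>
  In Sweedler-type notation, \<open>w (c \<triangleright> v) = v \<otimes>\<^sub>M 1\<close> for \<open>\<chi>\<^sup># 1 = w \<otimes> c\<close>. Both sides have the same image
  under every \<open>\<chi>(a \<otimes> _)\<close>: on the left it is \<open>\<chi>(a \<otimes> w) (c \<triangleright> v)\<close>, which is the value at \<open>v\<close> of the operator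
  of \<open>\<chi>(a \<otimes> w) \<otimes> c = 1 \<otimes> a\<close>, hence \<open>a \<triangleright> v\<close>.
\<close>

lemma expand_in_cs_one:
  assumes v: "v \<in> carrier P"
  shows "tensor_lift K W (\<lambda>w c. rmul (act c v) w) cs_one = pure_over v \<one>\<^bsub>P\<^esub>"
proof (rule chi_eqI)
  note bil = rmul_act_bilinear[OF v]
  show "tensor_lift K W (\<lambda>w c. rmul (act c v) w) cs_one \<in> carrier W"
    by (rule linear_on_closed[OF tensor_lift_linear[OF over_module A.algebra_module over_module bil] cs_one_closed])
  fix a assume a: "a \<in> carrier A"
  have "chi K P act (tens K A W a (tensor_lift K W (\<lambda>w c. rmul (act c v) w) cs_one)) =
    tensor_lift K P (\<lambda>w c. chi K P act (tens K A W a (rmul (act c v) w))) cs_one"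
    by (rule linear_tensor_lift[OF over_module A.algebra_module over_module P.algebra_module bil chi_tens_linear[OF a] cs_one_closed])
  also have "\<dots> = tensor_lift K P (\<lambda>w c. tensor_act (tens K P A (chi K P act (tens K A W a w)) c) v) cs_one"
    by (rule tensor_lift_cong[OF over_module A.algebra_module P.algebra_module
          bilinear_compose_linear[OF chi_tens_bilinear[OF a] tensor_act_linear[OF v]] cs_one_closed])
      (use a v in \<open>simp add: chi_rmul\<close>)
  also have "\<dots> = tensor_act (tensor_lift K (tensor K P A) (\<lambda>w c. tens K P A (chi K P act (tens K A W a w)) c) cs_one) v"
    by (rule linear_tensor_lift[OF over_module A.algebra_module _ P.algebra_module
          chi_tens_bilinear[OF a] tensor_act_linear[OF v] cs_one_closed, symmetric]) simp
  also have "\<dots> = chi K P act (tens K A W a (pure_over v \<one>\<^bsub>P\<^esub>))"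
    using a v by (simp add: chi_cs_one)
  finally show "chi K P act (tens K A W a (tensor_lift K W (\<lambda>w c. rmul (act c v) w) cs_one)) =
    chi K P act (tens K A W a (pure_over v \<one>\<^bsub>P\<^esub>))" .
qed (use v in simp)

text \<open>
  Left and right multiplication on \<open>P \<otimes>\<^sub>M P\<close> commute, so the value at \<open>v\<close> is
  \<open>\<chi>(a \<otimes> u (w (c \<triangleright> v))) = \<chi>(a \<otimes> u v \<otimes>\<^sub>M 1)\<close>.
\<close>

lemma tensor_act_galois_psi:
  assumes a: "a \<in> carrier A" and u: "u \<in> carrier P" and v: "v \<in> carrier P"
  shows "tensor_act (galois_psi a u) v = act a (u \<otimes>\<^bsub>P\<^esub> v)"
proof -
  note bil = rmul_act_bilinear[OF v]
  have lin: "linear_on K W P (\<lambda>w. chi K P act (tens K A W a (lmul u w)))"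
    by (rule linear_on_compose[OF lmul_linear[OF u] chi_tens_linear[OF a]])
  have "tensor_act (galois_psi a u) v =
      tensor_lift K P (\<lambda>w c. tensor_act (tens K P A (chi K P act (tens K A W a (lmul u w))) c) v) cs_one"
    unfolding galois_psi_def
    by (rule linear_tensor_lift[OF over_module A.algebra_module _ P.algebra_module galois_psi_inner[OF a u] tensor_act_linear[OF v] cs_one_closed]) simp
  also have "\<dots> = tensor_lift K P (\<lambda>w c. chi K P act (tens K A W a (lmul u (rmul (act c v) w)))) cs_one"
    by (rule tensor_lift_cong[OF over_module A.algebra_module P.algebra_module bilinear_compose_linear[OF bil lin] cs_one_closed])
      (use a u v in \<open>simp add: lmul_rmul chi_rmul\<close>)
  also have "\<dots> = chi K P act (tens K A W a (lmul u (tensor_lift K W (\<lambda>w c. rmul (act c v) w) cs_one)))"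
    by (rule linear_tensor_lift[OF over_module A.algebra_module over_module P.algebra_module bil lin cs_one_closed, symmetric])
  also have "\<dots> = act a (u \<otimes>\<^bsub>P\<^esub> v)"
    using a u v by (simp add: expand_in_cs_one)
  finally show ?thesis .
qed

text \<open>
  The map \<open>A \<rightarrow> P\<close> of the algebra bundle, made extensional so that it belongs to \<open>linear_maps\<close>.
\<close>

definition act_on_one :: "'a \<Rightarrow> 'p"
  where "act_on_one = (\<lambda>a\<in>carrier A. act a \<one>\<^bsub>P\<^esub>)"

lemma chi_cong:
  assumes x: "x \<in> carrier (tensor K A W)"
    and eq: "\<And>a u. \<lbrakk>a \<in> carrier A; u \<in> carrier P\<rbrakk> \<Longrightarrow> act' a u = act a u"
  shows "chi K P act' x = chi K P act x"
  unfolding chi_def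
proof (rule tensor_lift_cong[OF _ _ _ chi_bilinear x])
  show "tensor_lift K P (\<lambda>u v. act' a u \<otimes>\<^bsub>P\<^esub> v) w = tensor_lift K P (\<lambda>u v. act a u \<otimes>\<^bsub>P\<^esub> v) w"
    if "a \<in> carrier A" "w \<in> carrier W" for a w
    by (rule over_lift_cong[OF _ chi_inner_balanced that(2)]) (use that eq in simp_all)
qed simp_all

text \<open>
  The bundle action is only known to agree with \<open>\<triangleright>\<close> on the carriers, hence the transfer of the Galois
  map to actions that agree there.
\<close>

lemma galois_map_cong:
  assumes eq: "\<And>a u. \<lbrakk>a \<in> carrier A; u \<in> carrier P\<rbrakk> \<Longrightarrow> act' a u = act a u"
  shows "galois_map K P A invariants act' cs"
  unfolding galois_map_def Let_def
proof (intro conjI ballI)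
  show "cs \<in> linear_maps K P (tensor K W A)"
    using galois unfolding galois_map_def Let_def by simp
  fix x assume x: "x \<in> carrier W"
  have "partial_trace K A W (cs \<circ> chi K P act') x = partial_trace K A W (cs \<circ> chi K P act) x"
    unfolding partial_trace_def Let_def
    by (rule finsum_cong_pointwise) (simp add: chi_cong[OF _ eq] x chosen_basis_closed)
  then show "partial_trace K A W (cs \<circ> chi K P act') x = x"
    using trace_cs_chi[OF x] by simp
next
  fix y assume y: "y \<in> carrier (tensor K A P)"
  have z: "assoc_left K A W A (tensor_map K A (tensor K W A) id cs y) \<in> carrier (tensor K (tensor K A W) A)"
    by (rule linear_on_closed[OF linear_on_compose[OF tensor_map_linear assoc_left_linear] y])
      (simp_all add: linear_on_id_const cs_linear)
  have "tensor_map K P A (chi K P act') id z = tensor_map K P A (chi K P act) id z"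
    if "z \<in> carrier (tensor K (tensor K A W) A)" for z
    unfolding tensor_map_def
    by (rule tensor_lift_cong[OF _ _ _ bilinear_on_compose[OF tens_bilinear chi_linear linear_on_id_const] that])
      (simp_all add: chi_cong[OF _ eq])
  then show "tensor_map K P A (chi K P act') id
      (assoc_left K A W A (tensor_map K A (tensor K W A) id cs y)) = flip K A P y"
    using chi_cs[OF y] z by simp
qed

section \<open>Factorisation identities and the bundle structure\<close>

lemma psi_module_iff:
  "psi_module K P A \<Psi> P (\<lambda>u v. u \<otimes>\<^bsub>P\<^esub> v) act \<longleftrightarrow>
    (\<forall>a\<in>carrier A. \<forall>u\<in>carrier P. \<forall>v\<in>carrier P. tensor_act (\<Psi> (tens K A P a u)) v = act a (u \<otimes>\<^bsub>P\<^esub> v))"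
  unfolding psi_module_def tensor_act_def using P.regular_module left_alg_module_axioms by auto

context
  fixes \<Psi>
  assumes \<Psi>: "\<Psi> \<in> linear_maps K (tensor K A P) (tensor K P A)"
    and \<Psi>_module: "psi_module K P A \<Psi> P (\<lambda>u v. u \<otimes>\<^bsub>P\<^esub> v) act"
begin

lemma \<Psi>_linear: "linear_on K (tensor K A P) (tensor K P A) \<Psi>"
  by (rule linear_on_linear_maps[OF \<Psi>])

lemma tensor_act_\<Psi>: "\<lbrakk>a \<in> carrier A; u \<in> carrier P; v \<in> carrier P\<rbrakk> \<Longrightarrow>
    tensor_act (\<Psi> (tens K A P a u)) v = act a (u \<otimes>\<^bsub>P\<^esub> v)"
  using \<Psi>_module unfolding psi_module_iff by blast

lemma \<Psi>_closed [simp]: "x \<in> carrier (tensor K A P) \<Longrightarrow> \<Psi> x \<in> carrier (tensor K P A)"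
  using linear_on_closed[OF \<Psi>_linear] .

lemma assoc_closed [simp]:
  "\<lbrakk>module K U; module K V; module K X; x \<in> carrier (tensor K U (tensor K V X))\<rbrakk> \<Longrightarrow>
    assoc_left K U V X x \<in> carrier (tensor K (tensor K U V) X)"
  "\<lbrakk>module K U; module K V; module K X; y \<in> carrier (tensor K (tensor K U V) X)\<rbrakk> \<Longrightarrow>
    assoc_right K U V X y \<in> carrier (tensor K U (tensor K V X))"
  using linear_on_closed[OF assoc_left_linear] linear_on_closed[OF assoc_right_linear] by blast+

text \<open>
  The stages of the two factorisation identities, after the rebracketing that precedes each of them:
  multiplying the two factors in \<open>A\<close> (\<open>mult_right\<close>) or in \<open>P\<close> (\<open>mult_left\<close>), and moving a factor across
  by \<open>\<Psi>\<close>. The four lemmas about \<open>tensor_act\<close> below say that on operators these stages are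
  composition with an action or a multiplication.
\<close>

abbreviation "mult_right \<equiv> \<lambda>x. tensor_map K P A id (mult_map K A) (assoc_right K P A A x)"
abbreviation "mult_left \<equiv> \<lambda>x. tensor_map K P A (mult_map K P) id (assoc_left K P P A x)"
abbreviation "cross_left \<equiv> \<lambda>x. tensor_map K (tensor K P A) A \<Psi> id (assoc_left K A P A x)"
abbreviation "cross_right \<equiv> \<lambda>x. tensor_map K P (tensor K P A) id \<Psi> (assoc_right K P A P x)"

lemma crossing_linear:
  "linear_on K (tensor K (tensor K P A) A) (tensor K P A) mult_right"
  "linear_on K (tensor K P (tensor K P A)) (tensor K P A) mult_left"
  "linear_on K (tensor K A (tensor K P A)) (tensor K (tensor K P A) A) cross_left"
  "linear_on K (tensor K (tensor K P A) P) (tensor K P (tensor K P A)) cross_right"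
  by (rule linear_on_compose[OF assoc_right_linear tensor_map_linear]
           linear_on_compose[OF assoc_left_linear tensor_map_linear];
      simp add: linear_on_id_const A.mult_map_linear P.mult_map_linear \<Psi>_linear)+

lemmas crossing_closed [simp] = crossing_linear[THEN linear_on_closed]

lemma tensor_act_mult_right:
  assumes s: "s \<in> carrier (tensor K P A)" and b: "b \<in> carrier A" and v: "v \<in> carrier P"
  shows "tensor_act (mult_right (tens K (tensor K P A) A s b)) v = tensor_act s (act b v)"
proof (rule tensor_linear_eqI[OF _ _ s])
  show "linear_on K (tensor K P A) P (\<lambda>s. tensor_act (mult_right (tens K (tensor K P A) A s b)) v)"
    using b v by (intro linear_on_compose[OF bilinear_on_left[OF tens_bilinear]
      linear_on_compose[OF crossing_linear(1) tensor_act_linear]] modules)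
  show "linear_on K (tensor K P A) P (\<lambda>s. tensor_act s (act b v))"
    using b v by (intro tensor_act_linear act_closed)
  show "tensor_act (mult_right (tens K (tensor K P A) A (tens K P A u a) b)) v = tensor_act (tens K P A u a) (act b v)"
    if "u \<in> carrier P" "a \<in> carrier A" for u a
    using b v that
    by (simp add: assoc_right_tens tensor_map_tens linear_on_id_const A.mult_map_linear A.mult_map_tens act_mult)
qed simp_all

lemma tensor_act_cross_left:
  assumes a: "a \<in> carrier A" and s: "s \<in> carrier (tensor K P A)" and v: "v \<in> carrier P"
  shows "tensor_act (mult_right (cross_left (tens K A (tensor K P A) a s))) v = act a (tensor_act s v)"
proof (rule tensor_linear_eqI[OF _ _ s])
  show "linear_on K (tensor K P A) P (\<lambda>s. tensor_act (mult_right (cross_left (tens K A (tensor K P A) a s))) v)"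
    using a v by (intro linear_on_compose[OF bilinear_on_right[OF tens_bilinear]
      linear_on_compose[OF crossing_linear(3) linear_on_compose[OF crossing_linear(1) tensor_act_linear]]] modules)
  show "linear_on K (tensor K P A) P (\<lambda>s. act a (tensor_act s v))"
    using a v by (intro linear_on_compose[OF tensor_act_linear bilinear_on_right[OF act_bilinear]])
  show "tensor_act (mult_right (cross_left (tens K A (tensor K P A) a (tens K P A u b)))) v = act a (tensor_act (tens K P A u b) v)"
    if "u \<in> carrier P" "b \<in> carrier A" for u b
    using a v that
    by (simp add: assoc_left_tens tensor_map_tens linear_on_id_const \<Psi>_linear tensor_act_mult_right tensor_act_\<Psi>)
qed simp_all

lemma tensor_act_mult_left:
  assumes p: "p \<in> carrier P" and r: "r \<in> carrier (tensor K P A)" and v: "v \<in> carrier P"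
  shows "tensor_act (mult_left (tens K P (tensor K P A) p r)) v = p \<otimes>\<^bsub>P\<^esub> tensor_act r v"
proof (rule tensor_linear_eqI[OF _ _ r])
  show "linear_on K (tensor K P A) P (\<lambda>r. tensor_act (mult_left (tens K P (tensor K P A) p r)) v)"
    using p v by (intro linear_on_compose[OF bilinear_on_right[OF tens_bilinear]
      linear_on_compose[OF crossing_linear(2) tensor_act_linear]] modules)
  show "linear_on K (tensor K P A) P (\<lambda>r. p \<otimes>\<^bsub>P\<^esub> tensor_act r v)"
    using p v by (intro linear_on_compose[OF tensor_act_linear bilinear_on_right[OF P.mult_bilinear]])
  show "tensor_act (mult_left (tens K P (tensor K P A) p (tens K P A u a))) v = p \<otimes>\<^bsub>P\<^esub> tensor_act (tens K P A u a) v"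
    if "u \<in> carrier P" "a \<in> carrier A" for u a
    using p v that
    by (simp add: assoc_left_tens tensor_map_tens linear_on_id_const P.mult_map_linear P.mult_map_tens P.m_assoc)
qed simp_all

lemma tensor_act_cross_right:
  assumes s: "s \<in> carrier (tensor K P A)" and u: "u \<in> carrier P" and v: "v \<in> carrier P"
  shows "tensor_act (mult_left (cross_right (tens K (tensor K P A) P s u))) v = tensor_act s (u \<otimes>\<^bsub>P\<^esub> v)"
proof (rule tensor_linear_eqI[OF _ _ s])
  show "linear_on K (tensor K P A) P (\<lambda>s. tensor_act (mult_left (cross_right (tens K (tensor K P A) P s u))) v)"
    using u v by (intro linear_on_compose[OF bilinear_on_left[OF tens_bilinear]
      linear_on_compose[OF crossing_linear(4) linear_on_compose[OF crossing_linear(2) tensor_act_linear]]] modules)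
  show "linear_on K (tensor K P A) P (\<lambda>s. tensor_act s (u \<otimes>\<^bsub>P\<^esub> v))"
    using u v by (intro tensor_act_linear P.m_closed)
  show "tensor_act (mult_left (cross_right (tens K (tensor K P A) P (tens K P A p c) u))) v = tensor_act (tens K P A p c) (u \<otimes>\<^bsub>P\<^esub> v)"
    if "p \<in> carrier P" "c \<in> carrier A" for p c
    using u v that
    by (simp add: assoc_right_tens tensor_map_tens linear_on_id_const \<Psi>_linear tensor_act_mult_left tensor_act_\<Psi>)
qed simp_all

text \<open>
  Both sides are linear, so pure tensors \<open>(a \<otimes> b) \<otimes> u\<close> suffice; there both sides have the operator
  \<open>v \<mapsto> a \<triangleright> (b \<triangleright> (u v))\<close>.
\<close>

lemma factorisation_mult_A:
  assumes x: "x \<in> carrier (tensor K (tensor K A A) P)"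
  shows "\<Psi> (tensor_map K A P (mult_map K A) id x) =
    mult_right (cross_left (tensor_map K A (tensor K P A) id \<Psi> (assoc_right K A A P x)))"
proof (rule tensor_linear_eqI[OF _ _ x])
  let ?L = "\<lambda>x. \<Psi> (tensor_map K A P (mult_map K A) id x)"
  let ?R = "\<lambda>x. mult_right (cross_left (tensor_map K A (tensor K P A) id \<Psi> (assoc_right K A A P x)))"
  show L: "linear_on K (tensor K (tensor K A A) P) (tensor K P A) ?L"
    by (intro linear_on_compose[OF tensor_map_linear \<Psi>_linear] A.mult_map_linear linear_on_id_const modules)
  show R: "linear_on K (tensor K (tensor K A A) P) (tensor K P A) ?R"
    by (intro linear_on_compose[OF assoc_right_linear linear_on_compose[OF tensor_map_linear
          linear_on_compose[OF crossing_linear(3) crossing_linear(1)]]] linear_on_id_const \<Psi>_linear modules)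
  fix t u assume t: "t \<in> carrier (tensor K A A)" and u: "u \<in> carrier P"
  show "?L (tens K (tensor K A A) P t u) = ?R (tens K (tensor K A A) P t u)"
  proof (rule tensor_linear_eqI[OF _ _ t])
    show "linear_on K (tensor K A A) (tensor K P A) (\<lambda>t. ?L (tens K (tensor K A A) P t u))"
      by (rule linear_on_compose[OF bilinear_on_left[OF tens_bilinear u] L]) simp_all
    show "linear_on K (tensor K A A) (tensor K P A) (\<lambda>t. ?R (tens K (tensor K A A) P t u))"
      by (rule linear_on_compose[OF bilinear_on_left[OF tens_bilinear u] R]) simp_all
    fix a b assume a: "a \<in> carrier A" and b: "b \<in> carrier A"
    show "?L (tens K (tensor K A A) P (tens K A A a b) u) = ?R (tens K (tensor K A A) P (tens K A A a b) u)"
      by (rule tensor_act_eqI)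
        (use a b u in \<open>simp_all add: assoc_right_tens tensor_map_tens linear_on_id_const \<Psi>_linear
          A.mult_map_linear A.mult_map_tens tensor_act_cross_left tensor_act_\<Psi> act_mult\<close>)
  qed simp_all
qed simp_all

text \<open>
  As before, on \<open>a \<otimes> (u \<otimes> u')\<close> both sides have the operator \<open>v \<mapsto> a \<triangleright> (u u' v)\<close>.
\<close>

lemma factorisation_mult_P:
  assumes x: "x \<in> carrier (tensor K A (tensor K P P))"
  shows "\<Psi> (tensor_map K A P id (mult_map K P) x) =
    mult_left (cross_right (tensor_map K (tensor K P A) P \<Psi> id (assoc_left K A P P x)))"
proof (rule tensor_linear_eqI[OF _ _ x])
  let ?L = "\<lambda>x. \<Psi> (tensor_map K A P id (mult_map K P) x)"
  let ?R = "\<lambda>x. mult_left (cross_right (tensor_map K (tensor K P A) P \<Psi> id (assoc_left K A P P x)))"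
  show L: "linear_on K (tensor K A (tensor K P P)) (tensor K P A) ?L"
    by (intro linear_on_compose[OF tensor_map_linear \<Psi>_linear] P.mult_map_linear linear_on_id_const modules)
  show R: "linear_on K (tensor K A (tensor K P P)) (tensor K P A) ?R"
    by (intro linear_on_compose[OF assoc_left_linear linear_on_compose[OF tensor_map_linear
          linear_on_compose[OF crossing_linear(4) crossing_linear(2)]]] linear_on_id_const \<Psi>_linear modules)
  fix a t assume a: "a \<in> carrier A" and t: "t \<in> carrier (tensor K P P)"
  show "?L (tens K A (tensor K P P) a t) = ?R (tens K A (tensor K P P) a t)"
  proof (rule tensor_linear_eqI[OF _ _ t])
    show "linear_on K (tensor K P P) (tensor K P A) (\<lambda>t. ?L (tens K A (tensor K P P) a t))"
      by (rule linear_on_compose[OF bilinear_on_right[OF tens_bilinear a] L]) simp_all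
    show "linear_on K (tensor K P P) (tensor K P A) (\<lambda>t. ?R (tens K A (tensor K P P) a t))"
      by (rule linear_on_compose[OF bilinear_on_right[OF tens_bilinear a] R]) simp_all
    fix u v assume u: "u \<in> carrier P" and v: "v \<in> carrier P"
    show "?L (tens K A (tensor K P P) a (tens K P P u v)) = ?R (tens K A (tensor K P P) a (tens K P P u v))"
      by (rule tensor_act_eqI)
        (use a u v in \<open>simp_all add: assoc_left_tens tensor_map_tens linear_on_id_const \<Psi>_linear
          P.mult_map_linear P.mult_map_tens tensor_act_cross_right tensor_act_\<Psi> P.m_assoc\<close>)
  qed simp_all
qed simp_all

lemma factorisation: "factorisation_datum K P A \<Psi>"
  unfolding factorisation_datum_def
proof (intro conjI ballI)
  show "unital_algebra K P" "unital_algebra K A" by unfold_locales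
  show "\<Psi> (tens K A P \<one>\<^bsub>A\<^esub> u) = tens K P A u \<one>\<^bsub>A\<^esub>" if "u \<in> carrier P" for u
    by (rule tensor_act_eqI) (use that in \<open>simp_all add: tensor_act_\<Psi> act_one\<close>)
  show "\<Psi> (tens K A P a \<one>\<^bsub>P\<^esub>) = tens K P A \<one>\<^bsub>P\<^esub> a" if "a \<in> carrier A" for a
    by (rule tensor_act_eqI) (use that in \<open>simp_all add: tensor_act_\<Psi>\<close>)
qed (rule \<Psi> factorisation_mult_A factorisation_mult_P, assumption?)+

lemma lift_act_on_one:
  assumes t: "t \<in> carrier (tensor K P A)"
  shows "tensor_lift K P (\<lambda>u' a'. u' \<otimes>\<^bsub>P\<^esub> act_on_one a') t = tensor_act t \<one>\<^bsub>P\<^esub>"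
  unfolding tensor_act_def
  by (rule tensor_lift_cong[OF _ _ _ tensor_act_bilinear t]) (simp_all add: act_on_one_def)

lemma bundle_action_act_on_one:
  "\<lbrakk>a \<in> carrier A; u \<in> carrier P\<rbrakk> \<Longrightarrow> bundle_action K P A \<Psi> act_on_one a u = act a u"
  unfolding bundle_action_def by (simp add: lift_act_on_one tensor_act_\<Psi>)

text \<open>
  The condition in an algebra bundle concerns \<open>a \<triangleright> m\<close> only, whereas the invariants involve all
  \<open>a \<triangleright> (u m)\<close>. The latter is \<open>T(m)\<close> for the operator \<open>T\<close> of \<open>\<Psi> (a \<otimes> u)\<close>, a sum of terms \<open>x (b \<triangleright> m)\<close>, so
  the condition on single elements \<open>b \<triangleright> m\<close> suffices.
\<close>

lemma invariant_iff_act_on_one: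
  assumes m: "m \<in> carrier P"
  shows "(\<forall>a\<in>carrier A. act a m = act a \<one>\<^bsub>P\<^esub> \<otimes>\<^bsub>P\<^esub> m) \<longleftrightarrow> m \<in> invariants"
proof
  assume *: "\<forall>a\<in>carrier A. act a m = act a \<one>\<^bsub>P\<^esub> \<otimes>\<^bsub>P\<^esub> m"
  have "tensor_act t m = tensor_act t \<one>\<^bsub>P\<^esub> \<otimes>\<^bsub>P\<^esub> m" if t: "t \<in> carrier (tensor K P A)" for t
    by (rule tensor_linear_eqI[OF _ _ t tensor_act_linear linear_on_bilinear_left[OF P.mult_bilinear tensor_act_linear]])
      (use m * in \<open>auto simp: P.m_assoc\<close>)
  then have "act a (u \<otimes>\<^bsub>P\<^esub> m) = act a u \<otimes>\<^bsub>P\<^esub> m" if "a \<in> carrier A" "u \<in> carrier P" for a u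
    using tensor_act_\<Psi>[OF that m] tensor_act_\<Psi>[OF that P.one_closed] that by simp
  then show "m \<in> invariants" using m unfolding invariants_def by blast
next
  assume "m \<in> invariants"
  then show "\<forall>a\<in>carrier A. act a m = act a \<one>\<^bsub>P\<^esub> \<otimes>\<^bsub>P\<^esub> m"
    using invariantsD(1)[of m "\<one>\<^bsub>P\<^esub>"] m by simp
qed

lemma algebra_bundle_act_on_one: "algebra_bundle K P invariants A \<Psi> act_on_one"
proof -
  have act_on_one: "act_on_one a = act a \<one>\<^bsub>P\<^esub>" if "a \<in> carrier A" for a
    using that by (simp add: act_on_one_def)
  show ?thesis
    unfolding algebra_bundle_def
  proof (intro conjI ballI)
    show "factorisation_datum K P A \<Psi>" by (rule factorisation)
    show "finite_dim K A" by (rule finite_dim_A)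
    show "act_on_one \<in> linear_maps K A P"
      unfolding act_on_one_def by (intro restrict_linear_maps bilinear_on_left[OF act_bilinear] modules P.one_closed)
    show "act_on_one (a \<otimes>\<^bsub>A\<^esub> b) = tensor_lift K P (\<lambda>u' a'. u' \<otimes>\<^bsub>P\<^esub> act_on_one a') (\<Psi> (tens K A P a (act_on_one b)))"
      if "a \<in> carrier A" "b \<in> carrier A" for a b
      using bundle_action_act_on_one[OF that(1), of "act_on_one b"] that
      unfolding bundle_action_def by (simp add: act_on_one act_mult)
    show "act_on_one \<one>\<^bsub>A\<^esub> = \<one>\<^bsub>P\<^esub>" by (simp add: act_on_one act_one)
    show "\<exists>cs. galois_map K P A invariants (bundle_action K P A \<Psi> act_on_one) cs"
      using galois_map_cong[OF bundle_action_act_on_one] by blast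
    have "(\<forall>a\<in>carrier A. bundle_action K P A \<Psi> act_on_one a m = act_on_one a \<otimes>\<^bsub>P\<^esub> m) \<longleftrightarrow> m \<in> invariants"
      if "m \<in> carrier P" for m
      using invariant_iff_act_on_one[OF that] that by (simp add: bundle_action_act_on_one act_on_one)
    then show "invariants = {m \<in> carrier P. \<forall>a\<in>carrier A. bundle_action K P A \<Psi> act_on_one a m = act_on_one a \<otimes>\<^bsub>P\<^esub> m}"
      using invariantsD(2) by blast
  qed
qed

lemma psi_module_determined: "\<lbrakk>a \<in> carrier A; u \<in> carrier P\<rbrakk> \<Longrightarrow> \<Psi> (tens K A P a u) = galois_psi a u"
  by (intro tensor_act_eqI) (simp_all add: tensor_act_galois_psi galois_psi_closed tensor_act_\<Psi>)

end

text \<open>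
  As \<open>\<Psi> (a \<otimes> 1) = 1 \<otimes> a\<close>, the bundle action at \<open>1\<close> is \<open>e\<close> itself.
\<close>

lemma bundle_act_on_one_unique:
  assumes alg: "algebra_bundle K P invariants A \<Psi> e"
    and act: "\<And>a u. \<lbrakk>a \<in> carrier A; u \<in> carrier P\<rbrakk> \<Longrightarrow> bundle_action K P A \<Psi> e a u = act a u"
  shows "e = act_on_one"
proof -
  have e: "e \<in> linear_maps K A P" and \<Psi>: "factorisation_datum K P A \<Psi>"
    using alg unfolding algebra_bundle_def by auto
  note elin = linear_on_linear_maps[OF e]
  have bil: "bilinear_on K P A P (\<lambda>u' a'. u' \<otimes>\<^bsub>P\<^esub> e a')"
    by (rule bilinear_on_compose[OF P.mult_bilinear linear_on_id elin])
  have "e a = act a \<one>\<^bsub>P\<^esub>" if a: "a \<in> carrier A" for a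
  proof -
    have "\<Psi> (tens K A P a \<one>\<^bsub>P\<^esub>) = tens K P A \<one>\<^bsub>P\<^esub> a"
      using \<Psi> a unfolding factorisation_datum_def by blast
    then have "bundle_action K P A \<Psi> e a \<one>\<^bsub>P\<^esub> = \<one>\<^bsub>P\<^esub> \<otimes>\<^bsub>P\<^esub> e a"
      unfolding bundle_action_def using a by (simp add: tensor_lift_tens bil)
    then show ?thesis using act[OF a P.one_closed] linear_on_closed[OF elin a] by simp
  qed
  moreover have "e \<in> extensional (carrier A)" using e unfolding linear_maps_def by (auto simp: PiE_def)
  ultimately show ?thesis unfolding act_on_one_def by (intro extensionalityI[where A = "carrier A"]) auto
qed

lemma psi_module_unique:
  assumes "\<Psi> \<in> linear_maps K (tensor K A P) (tensor K P A)" "psi_module K P A \<Psi> P (\<lambda>u v. u \<otimes>\<^bsub>P\<^esub> v) act"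
    and "\<Phi> \<in> linear_maps K (tensor K A P) (tensor K P A)" "psi_module K P A \<Phi> P (\<lambda>u v. u \<otimes>\<^bsub>P\<^esub> v) act"
  shows "\<Psi> = \<Phi>"
proof (rule extensionalityI)
  show "\<Psi> \<in> extensional (carrier (tensor K A P))" "\<Phi> \<in> extensional (carrier (tensor K A P))"
    using assms unfolding linear_maps_def by (auto simp: PiE_def)
  note lin = linear_on_linear_maps[OF assms(1)] linear_on_linear_maps[OF assms(3)]
  fix x assume x: "x \<in> carrier (tensor K A P)"
  show "\<Psi> x = \<Phi> x"
    by (rule tensor_linear_eqI[OF _ _ x lin])
      (simp_all add: psi_module_determined[OF assms(1,2)] psi_module_determined[OF assms(3,4)])
qed

lemma psi_module_exists:
  obtains \<Psi> where "\<Psi> \<in> linear_maps K (tensor K A P) (tensor K P A)"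
    and "psi_module K P A \<Psi> P (\<lambda>u v. u \<otimes>\<^bsub>P\<^esub> v) act"
proof
  let ?\<Psi> = "\<lambda>x\<in>carrier (tensor K A P). tensor_lift K (tensor K P A) galois_psi x"
  show "?\<Psi> \<in> linear_maps K (tensor K A P) (tensor K P A)"
    by (intro restrict_linear_maps tensor_lift_linear galois_psi_bilinear modules)
  show "psi_module K P A ?\<Psi> P (\<lambda>u v. u \<otimes>\<^bsub>P\<^esub> v) act"
    unfolding psi_module_iff by (simp add: tensor_lift_tens galois_psi_bilinear tensor_act_galois_psi)
qed

end

theorem theorem2p6:
  fixes K :: "'k ring"
    and P :: "('k, 'p) module"
    and A :: "('k, 'a) module"
    and act :: "'a \<Rightarrow> 'p \<Rightarrow> 'p"
    and cs :: "'p \<Rightarrow> (('p \<times> 'p \<Rightarrow> 'k) set \<times> 'a \<Rightarrow> 'k) set"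
    and M :: "'p set"
  assumes "field K"
    and "unital_algebra K P" and "unital_algebra K A"
    and "finite_dim K A"
    and "left_alg_module K A P act"
    and M_def: "M = {m \<in> carrier P. \<forall>u\<in>carrier P. \<forall>a\<in>carrier A.
                  act a (u \<otimes>\<^bsub>P\<^esub> m) = act a u \<otimes>\<^bsub>P\<^esub> m}"
    and "galois_map K P A M act cs"
  shows
    "(\<exists>!\<Psi>. (\<exists>e. algebra_bundle K P M A \<Psi> e) \<and>
            psi_module K P A \<Psi> P (\<lambda>u v. u \<otimes>\<^bsub>P\<^esub> v) act) \<and>
     (\<forall>\<Psi>. (\<exists>e. algebra_bundle K P M A \<Psi> e) \<and>
            psi_module K P A \<Psi> P (\<lambda>u v. u \<otimes>\<^bsub>P\<^esub> v) act \<longrightarrow>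
        (\<forall>a\<in>carrier A. \<forall>u\<in>carrier P.
           \<Psi> (tens K A P a u) =
           tensor_lift K (tensor K P A)
             (\<lambda>w c. tens K P A
                      (chi K P act (tens K A (tensor_over K P M) a (left_mult_over K P M u w))) c)
             (cs \<one>\<^bsub>P\<^esub>)) \<and>
        (\<forall>e. algebra_bundle K P M A \<Psi> e \<and>
             (\<forall>a\<in>carrier A. \<forall>u\<in>carrier P. bundle_action K P A \<Psi> e a u = act a u)
             \<longleftrightarrow> e = (\<lambda>a\<in>carrier A. act a \<one>\<^bsub>P\<^esub>)))"
proof -
  interpret algebra_action K A P act
    by (rule algebra_action.intro[OF assms(5,2)])
  have M: "M = invariants" unfolding M_def invariants_def ..
  interpret galois_action K A P act cs
    using assms(4,7) by unfold_locales (simp_all add: M)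
  have bundle_linear: "\<Psi> \<in> linear_maps K (tensor K A P) (tensor K P A)"
    if "\<exists>e. algebra_bundle K P invariants A \<Psi> e" for \<Psi>
    using that unfolding algebra_bundle_def factorisation_datum_def by blast
  show ?thesis
    unfolding M
  proof (intro conjI allI impI ballI; (elim conjE)?)
    obtain \<Psi> where "\<Psi> \<in> linear_maps K (tensor K A P) (tensor K P A)"
      and "psi_module K P A \<Psi> P (\<lambda>u v. u \<otimes>\<^bsub>P\<^esub> v) act"
      by (rule psi_module_exists)
    then show "\<exists>!\<Psi>. (\<exists>e. algebra_bundle K P invariants A \<Psi> e) \<and> psi_module K P A \<Psi> P (\<lambda>u v. u \<otimes>\<^bsub>P\<^esub> v) act"
      using algebra_bundle_act_on_one psi_module_unique bundle_linear by (intro ex1I[of _ \<Psi>]) blast+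
  next
    fix \<Psi>
    assume alg: "\<exists>e. algebra_bundle K P invariants A \<Psi> e"
      and mod: "psi_module K P A \<Psi> P (\<lambda>u v. u \<otimes>\<^bsub>P\<^esub> v) act"
    note \<Psi> = bundle_linear[OF alg]
    show "\<Psi> (tens K A P a u) = tensor_lift K (tensor K P A)
        (\<lambda>w c. tens K P A (chi K P act (tens K A W a (left_mult_over K P invariants u w))) c) (cs \<one>\<^bsub>P\<^esub>)"
      if "a \<in> carrier A" "u \<in> carrier P" for a u
      using psi_module_determined[OF \<Psi> mod that] unfolding galois_psi_def .
    show "algebra_bundle K P invariants A \<Psi> e \<and>
        (\<forall>a\<in>carrier A. \<forall>u\<in>carrier P. bundle_action K P A \<Psi> e a u = act a u) \<longleftrightarrow>
        e = (\<lambda>a\<in>carrier A. act a \<one>\<^bsub>P\<^esub>)" for e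
      unfolding act_on_one_def[symmetric]
    proof
      assume "algebra_bundle K P invariants A \<Psi> e \<and>
        (\<forall>a\<in>carrier A. \<forall>u\<in>carrier P. bundle_action K P A \<Psi> e a u = act a u)"
      then show "e = act_on_one" by (intro bundle_act_on_one_unique[of \<Psi>]) simp_all
    next
      assume "e = act_on_one"
      then show "algebra_bundle K P invariants A \<Psi> e \<and>
        (\<forall>a\<in>carrier A. \<forall>u\<in>carrier P. bundle_action K P A \<Psi> e a u = act a u)"
        using algebra_bundle_act_on_one[OF \<Psi> mod] bundle_action_act_on_one[OF \<Psi> mod] by simp
    qed
  qed
qed

end
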